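(* Let $K\subseteq\mathbb{R}^d$ be compact. Then $(C^1(K),\|\cdot\|_{C^1(K)})$ is complete if and only if $K$ has finitely many connected components, each of which is pointwise Whitney regular.
   Context: $C^1(K)$ is the set of $f:K\to\mathbb{R}$ admitting a continuous $df:K\to\mathbb{R}^d$ with $\lim_{y\to x,\,y\in K\setminus\{x\}}\frac{f(y)-f(x)-\langle df(x),y-x\rangle}{|y-x|}=0$ for all $x\in K$, normed by $\|f\|_{C^1(K)}=\|f\|_K+\inf\{\|df\|_K: df \text{ a continuous derivative of } f\}$ ($\|\cdot\|_K$ the sup norm). A set $S$ is pointwise Whitney regular if for every $x\in S$ there are a neighbourhood $V_x$ of $x$ and $C_x>0$ such that every $y\in V_x\cap S$ is joined to $x$ by a rectifiable path in $S$ of length at most $C_x|x-y|$ (a rectifiable path is a continuous map $\gamma:[a,b]\to S$ of finite length $\sup\sum_j|\gamma(t_j)-\gamma(t_{j-1})|$). *)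

theory Defs
  imports "HOL-Analysis.Analysis"
begin

definition supnorm :: "'a set \<Rightarrow> ('a \<Rightarrow> 'b::real_normed_vector) \<Rightarrow> real" where
  "supnorm K g = (if K = {} then 0 else Sup ((\<lambda>x. norm (g x)) ` K))"

definition is_C1_deriv :: "'a::euclidean_space set \<Rightarrow> ('a \<Rightarrow> real) \<Rightarrow> ('a \<Rightarrow> 'a) \<Rightarrow> bool" where
  "is_C1_deriv K f df \<longleftrightarrow> continuous_on K df \<and>
     (\<forall>x\<in>K. ((\<lambda>y. (f y - f x - inner (df x) (y - x)) / norm (y - x)) \<longlongrightarrow> 0) (at x within K))"

definition C1 :: "'a::euclidean_space set \<Rightarrow> ('a \<Rightarrow> real) set" where
  "C1 K = {f. \<exists>df. is_C1_deriv K f df}"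

definition C1norm :: "'a::euclidean_space set \<Rightarrow> ('a \<Rightarrow> real) \<Rightarrow> real" where
  "C1norm K f = supnorm K f + Inf {supnorm K df | df. is_C1_deriv K f df}"

definition C1_complete :: "'a::euclidean_space set \<Rightarrow> bool" where
  "C1_complete K \<longleftrightarrow>
     (\<forall>u :: nat \<Rightarrow> 'a \<Rightarrow> real.
        (\<forall>n. u n \<in> C1 K) \<and>
        (\<forall>e>0. \<exists>N. \<forall>m\<ge>N. \<forall>n\<ge>N. C1norm K (\<lambda>x. u m x - u n x) < e)
        \<longrightarrow> (\<exists>f\<in>C1 K. (\<lambda>n. C1norm K (\<lambda>x. u n x - f x)) \<longlonglongrightarrow> 0))"

definition partition_sums :: "(real \<Rightarrow> 'a::metric_space) \<Rightarrow> real \<Rightarrow> real \<Rightarrow> real set" where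
  "partition_sums \<gamma> a b =
     {(\<Sum>j<length ts - 1. dist (\<gamma> (ts ! j)) (\<gamma> (ts ! Suc j))) | ts. sorted ts \<and> set ts \<subseteq> {a..b}}"

definition rectifiable :: "(real \<Rightarrow> 'a::metric_space) \<Rightarrow> real \<Rightarrow> real \<Rightarrow> bool" where
  "rectifiable \<gamma> a b \<longleftrightarrow> bdd_above (partition_sums \<gamma> a b)"

definition curve_length :: "(real \<Rightarrow> 'a::metric_space) \<Rightarrow> real \<Rightarrow> real \<Rightarrow> real" where
  "curve_length \<gamma> a b = Sup (partition_sums \<gamma> a b)"

definition pointwise_whitney_regular :: "'a::euclidean_space set \<Rightarrow> bool" where
  "pointwise_whitney_regular S \<longleftrightarrow>
     (\<forall>x\<in>S. \<exists>V C. open V \<and> x \<in> V \<and> C > 0 \<and>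
        (\<forall>y\<in>V \<inter> S. \<exists>(\<gamma> :: real \<Rightarrow> 'a) a b. a \<le> b \<and> continuous_on {a..b} \<gamma> \<and>
            \<gamma> ` {a..b} \<subseteq> S \<and> \<gamma> a = x \<and> \<gamma> b = y \<and>
            rectifiable \<gamma> a b \<and> curve_length \<gamma> a b \<le> C * norm (x - y)))"

end

theory Submission
  imports Defs "HOL-Complex_Analysis.Great_Picard"
begin

text \<open>For compact \<open>K\<close>, both sides are equivalent to pointwise Whitney regularity of \<open>K\<close> itself.

  If \<open>C\<^sup>1(K)\<close> is complete, uniform boundedness applied to the difference quotients at a point
  \<open>x\<close> gives \<open>|f y - f x| \<le> C |y - x| \<parallel>f\<parallel>\<close> for all \<open>f\<close>. Testing this with smoothed versions of
  the truncated \<open>\<epsilon>\<close>-chain distance from \<open>x\<close> bounds that distance near \<open>x\<close> by \<open>9 C |y - x|\<close>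
  uniformly in \<open>\<epsilon>\<close>, and the polygons through the chains converge, by Arzela-Ascoli, to a short
  path inside \<open>K\<close>.

  Conversely, along a short path the increment of a \<open>C\<^sup>1\<close> function is controlled by the supremum
  of its derivative, so a uniform limit of derivatives is a derivative of the limit.\<close>

section \<open>The seminorm on continuously differentiable functions\<close>

text \<open>Derivatives on \<open>K\<close> need not be unique (isolated points, \<open>K\<close>
  inside a hyperplane), and on total functions \<open>C1norm\<close> is only a seminorm. Hence
  estimates pass through a nearly optimal derivative, and uniform boundedness is proved directly for
  the functionals \<open>f y - f x\<close>. The obstacle to necessity is that the \<epsilon>-chain
  distance is Lipschitz only at scales below \<epsilon> and may jump beyond them, while a test
  function must lie in \<open>C1 K\<close> with a seminorm bound free of \<epsilon>. The soft
  minimum provides this bound: 9 is 2 for the sup norm (truncation at 1, error at most 1), plus 6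
  for gradients of nearby quadratics, plus 1 for all the others.\<close>

lemma is_C1_deriv_iff_has_derivative:
  "is_C1_deriv K f df \<longleftrightarrow>
     continuous_on K df \<and> (\<forall>x\<in>K. (f has_derivative inner (df x)) (at x within K))"
  unfolding is_C1_deriv_def has_derivative_within
  by (simp add: bounded_linear_inner_right diff_diff_eq)

lemma is_C1_deriv_continuous_on: "is_C1_deriv K f df \<Longrightarrow> continuous_on K f"
  unfolding is_C1_deriv_iff_has_derivative
  by (rule has_derivative_continuous_on) blast

lemma is_C1_deriv_add:
  "is_C1_deriv K f df \<Longrightarrow> is_C1_deriv K g dg \<Longrightarrow>
     is_C1_deriv K (\<lambda>x. f x + g x) (\<lambda>x. df x + dg x)"
  unfolding is_C1_deriv_iff_has_derivative
  by (auto intro!: continuous_on_add has_derivative_eq_rhs[OF has_derivative_add]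
      simp: inner_add_left fun_eq_iff)

lemma is_C1_deriv_scale:
  "is_C1_deriv K f df \<Longrightarrow> is_C1_deriv K (\<lambda>x. c * f x) (\<lambda>x. c *\<^sub>R df x)"
  unfolding is_C1_deriv_iff_has_derivative
  by (auto intro!: continuous_on_scaleR continuous_on_const
      has_derivative_eq_rhs[OF has_derivative_mult_right] simp: fun_eq_iff)

lemma is_C1_deriv_diff:
  "is_C1_deriv K f df \<Longrightarrow> is_C1_deriv K g dg \<Longrightarrow>
     is_C1_deriv K (\<lambda>x. f x - g x) (\<lambda>x. df x - dg x)"
  unfolding is_C1_deriv_iff_has_derivative
  by (auto intro!: continuous_on_diff has_derivative_eq_rhs[OF has_derivative_diff]
      simp: inner_diff_left fun_eq_iff)

lemma is_C1_deriv_zero: "is_C1_deriv K (\<lambda>x. 0) (\<lambda>x. 0)"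
  unfolding is_C1_deriv_def by simp

lemma C1_add: "f \<in> C1 K \<Longrightarrow> g \<in> C1 K \<Longrightarrow> (\<lambda>x. f x + g x) \<in> C1 K"
  unfolding C1_def using is_C1_deriv_add by blast

lemma C1_diff: "f \<in> C1 K \<Longrightarrow> g \<in> C1 K \<Longrightarrow> (\<lambda>x. f x - g x) \<in> C1 K"
  unfolding C1_def using is_C1_deriv_diff by blast

lemma C1_scale: "f \<in> C1 K \<Longrightarrow> (\<lambda>x. c * f x) \<in> C1 K"
  unfolding C1_def using is_C1_deriv_scale by blast

lemma C1_zero: "(\<lambda>x. 0) \<in> C1 K"
  unfolding C1_def using is_C1_deriv_zero by blast

lemma norm_le_supnorm:
  assumes "compact K" "continuous_on K g" "x \<in> K"
  shows "norm (g x) \<le> supnorm K g"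
proof -
  have "bounded ((\<lambda>x. norm (g x)) ` K)"
    using assms by (intro compact_imp_bounded compact_continuous_image continuous_intros)
  then show ?thesis
    using assms(3) unfolding supnorm_def by (auto intro!: cSup_upper bounded_imp_bdd_above)
qed

lemma supnorm_nonneg:
  assumes "compact K" "continuous_on K g"
  shows "0 \<le> supnorm K g"
proof (cases "K = {}")
  case False
  then obtain x where "x \<in> K" by blast
  then show ?thesis
    using norm_le_supnorm[OF assms] norm_ge_zero order_trans by blast
qed (simp add: supnorm_def)

text \<open>For empty \<open>K\<close> the bound on \<open>g\<close> says nothing and
  \<open>supnorm\<close> is 0, which \<open>0 \<le> B\<close> covers.\<close>

lemma supnorm_le:
  assumes "\<And>x. x \<in> K \<Longrightarrow> norm (g x) \<le> B" "0 \<le> B"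
  shows "supnorm K g \<le> B"
  using assms unfolding supnorm_def by (auto intro!: cSup_least)

lemma C1_deriv_supnorms_bdd_below:
  assumes "compact K"
  shows "bdd_below {supnorm K df | df. is_C1_deriv K f df}"
  using supnorm_nonneg[OF assms] unfolding is_C1_deriv_def by (intro bdd_belowI[of _ 0]) auto

lemma C1norm_le:
  assumes "compact K" "is_C1_deriv K f df"
    and "\<And>x. x \<in> K \<Longrightarrow> \<bar>f x\<bar> \<le> A" "\<And>x. x \<in> K \<Longrightarrow> norm (df x) \<le> B" "0 \<le> A" "0 \<le> B"
  shows "C1norm K f \<le> A + B"
proof -
  have "Inf {supnorm K df | df. is_C1_deriv K f df} \<le> supnorm K df"
    by (rule cInf_lower) (use C1_deriv_supnorms_bdd_below assms in auto)
  also have "\<dots> \<le> B"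
    using assms by (intro supnorm_le)
  finally have "Inf {supnorm K df | df. is_C1_deriv K f df} \<le> B" .
  moreover have "supnorm K f \<le> A"
    using assms by (intro supnorm_le) auto
  ultimately show ?thesis
    unfolding C1norm_def by linarith
qed

text \<open>The infimum over derivatives need not be attained, so a strict upper bound is traded for
  one concrete derivative; later estimates use \<open>A\<close> and \<open>B\<close> instead of
  \<open>Sup\<close> and \<open>Inf\<close>.\<close>

lemma C1norm_lessE:
  assumes "compact K" "f \<in> C1 K" "C1norm K f < e"
  obtains df A B where "is_C1_deriv K f df" "0 \<le> A" "0 \<le> B" "A + B < e"
    "\<And>x. x \<in> K \<Longrightarrow> \<bar>f x\<bar> \<le> A" "\<And>x. x \<in> K \<Longrightarrow> norm (df x) \<le> B"
proof -
  let ?S = "{supnorm K df | df. is_C1_deriv K f df}"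
  have "?S \<noteq> {}" "Inf ?S < e - supnorm K f"
    using assms unfolding C1_def C1norm_def by auto
  then obtain df where df: "is_C1_deriv K f df" "supnorm K df < e - supnorm K f"
    using cInf_lessD by (smt (verit) mem_Collect_eq)
  have cont: "continuous_on K f" "continuous_on K df"
    using df(1) is_C1_deriv_continuous_on unfolding is_C1_deriv_def by blast+
  show thesis
  proof (rule that[OF df(1)])
    show "0 \<le> supnorm K f" "0 \<le> supnorm K df"
      using supnorm_nonneg assms(1) cont by blast+
    show "supnorm K f + supnorm K df < e"
      using df by simp
    show "\<bar>f x\<bar> \<le> supnorm K f" "norm (df x) \<le> supnorm K df" if "x \<in> K" for x
      using norm_le_supnorm[OF assms(1) cont(1) that] norm_le_supnorm[OF assms(1) cont(2) that]
      by auto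
  qed
qed

lemma abs_le_C1norm:
  assumes "compact K" "f \<in> C1 K" "x \<in> K"
  shows "\<bar>f x\<bar> \<le> C1norm K f"
proof (rule dense_ge)
  fix e assume "C1norm K f < e"
  then show "\<bar>f x\<bar> \<le> e"
    using C1norm_lessE[OF assms(1,2)] assms(3) by (smt (verit))
qed

lemma C1norm_nonneg:
  assumes "compact K" "f \<in> C1 K"
  shows "0 \<le> C1norm K f"
proof (rule dense_ge)
  fix e assume "C1norm K f < e"
  then show "0 \<le> e"
    using C1norm_lessE[OF assms] by (smt (verit))
qed

lemma C1norm_triangle:
  assumes "compact K" "f \<in> C1 K" "g \<in> C1 K"
  shows "C1norm K (\<lambda>x. f x + g x) \<le> C1norm K f + C1norm K g"
proof (rule field_le_epsilon)
  fix e :: real assume e: "0 < e"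
  obtain df A B where f: "is_C1_deriv K f df" "0 \<le> A" "0 \<le> B" "A + B < C1norm K f + e/2"
    "\<And>x. x \<in> K \<Longrightarrow> \<bar>f x\<bar> \<le> A" "\<And>x. x \<in> K \<Longrightarrow> norm (df x) \<le> B"
    using C1norm_lessE[OF assms(1,2), of "C1norm K f + e/2"] e by auto
  obtain dg A' B' where g: "is_C1_deriv K g dg" "0 \<le> A'" "0 \<le> B'" "A' + B' < C1norm K g + e/2"
    "\<And>x. x \<in> K \<Longrightarrow> \<bar>g x\<bar> \<le> A'" "\<And>x. x \<in> K \<Longrightarrow> norm (dg x) \<le> B'"
    using C1norm_lessE[OF assms(1,3), of "C1norm K g + e/2"] e by auto
  have "C1norm K (\<lambda>x. f x + g x) \<le> (A + A') + (B + B')"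
  proof (rule C1norm_le[OF assms(1) is_C1_deriv_add[OF f(1) g(1)]])
    fix x assume x: "x \<in> K"
    show "\<bar>f x + g x\<bar> \<le> A + A'"
      using f(5)[OF x] g(5)[OF x] by linarith
    show "norm (df x + dg x) \<le> B + B'"
      using f(6)[OF x] g(6)[OF x] by (rule norm_triangle_mono)
  qed (use f g in auto)
  then show "C1norm K (\<lambda>x. f x + g x) \<le> C1norm K f + C1norm K g + e"
    using f(4) g(4) by linarith
qed

lemma C1norm_scale_le:
  assumes "compact K" "f \<in> C1 K"
  shows "C1norm K (\<lambda>x. c * f x) \<le> \<bar>c\<bar> * C1norm K f"
proof (rule field_le_epsilon)
  fix e :: real assume e: "0 < e"
  \<comment> \<open>The summand 1 keeps \<open>e'\<close> positive and finite when
    \<open>c = 0\<close>.\<close>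
  define e' where "e' = e / (\<bar>c\<bar> + 1)"
  have e': "0 < e'" "\<bar>c\<bar> * e' \<le> e"
    using e unfolding e'_def by (auto simp: field_simps)
  obtain df A B where f: "is_C1_deriv K f df" "0 \<le> A" "0 \<le> B" "A + B < C1norm K f + e'"
    "\<And>x. x \<in> K \<Longrightarrow> \<bar>f x\<bar> \<le> A" "\<And>x. x \<in> K \<Longrightarrow> norm (df x) \<le> B"
    using C1norm_lessE[OF assms, of "C1norm K f + e'"] e' by auto
  have "C1norm K (\<lambda>x. c * f x) \<le> \<bar>c\<bar> * A + \<bar>c\<bar> * B"
    by (rule C1norm_le[OF assms(1) is_C1_deriv_scale[OF f(1)]])
      (use f in \<open>auto simp: abs_mult intro!: mult_left_mono\<close>)
  also have "\<dots> = \<bar>c\<bar> * (A + B)"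
    by (simp add: algebra_simps)
  also have "\<dots> \<le> \<bar>c\<bar> * (C1norm K f + e')"
    using f(4) by (intro mult_left_mono) auto
  also have "\<dots> \<le> \<bar>c\<bar> * C1norm K f + e"
    using e'(2) by (simp add: algebra_simps)
  finally show "C1norm K (\<lambda>x. c * f x) \<le> \<bar>c\<bar> * C1norm K f + e" .
qed

lemma C1norm_minus_commute:
  assumes "compact K" "f \<in> C1 K" "g \<in> C1 K"
  shows "C1norm K (\<lambda>x. f x - g x) = C1norm K (\<lambda>x. g x - f x)"
  using C1norm_scale_le[OF assms(1) C1_diff[OF assms(2,3)], of "-1"]
    C1norm_scale_le[OF assms(1) C1_diff[OF assms(3,2)], of "-1"]
  by simp

lemma C1norm_diff_triangle:
  assumes "compact K" "f \<in> C1 K" "g \<in> C1 K" "h \<in> C1 K"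
  shows "C1norm K (\<lambda>x. f x - h x) \<le> C1norm K (\<lambda>x. f x - g x) + C1norm K (\<lambda>x. g x - h x)"
  using C1norm_triangle[OF assms(1) C1_diff[OF assms(2,3)] C1_diff[OF assms(3,4)]] by simp

text \<open>The pointwise hypothesis of uniform boundedness: for one \<open>f\<close> the quotients
  at \<open>x\<close> are bounded near \<open>x\<close> by differentiability with error 1, and at
  distance at least \<open>d\<close> by \<open>2 * N / d\<close>. This \<open>B\<close> depends on
  \<open>f\<close>; completeness will remove the dependence.\<close>

lemma C1_pointwise_lipschitz:
  assumes "compact K" "f \<in> C1 K" "x \<in> K"
  obtains B where "\<And>y. y \<in> K \<Longrightarrow> \<bar>f y - f x\<bar> \<le> B * norm (y - x)"
proof -
  obtain df where df: "is_C1_deriv K f df"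
    using assms unfolding C1_def by blast
  then have "(f has_derivative inner (df x)) (at x within K)"
    using assms unfolding is_C1_deriv_iff_has_derivative by blast
  then have "\<exists>d>0. \<forall>y\<in>K. norm (y - x) < d \<longrightarrow>
      norm (f y - f x - inner (df x) (y - x)) \<le> 1 * norm (y - x)"
    unfolding has_derivative_within_alt using zero_less_one by blast
  then obtain d where d: "d > 0"
    "\<And>y. y \<in> K \<Longrightarrow> norm (y - x) < d \<Longrightarrow> \<bar>f y - f x - inner (df x) (y - x)\<bar> \<le> norm (y - x)"
    by auto
  define N where "N = C1norm K f"
  have N: "\<bar>f y\<bar> \<le> N" if "y \<in> K" for y
    unfolding N_def using abs_le_C1norm assms that by blast
  have "N \<ge> 0"
    using N[OF assms(3)] by linarith
  show thesis
  proof (rule that)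
    fix y assume y: "y \<in> K"
    show "\<bar>f y - f x\<bar> \<le> (norm (df x) + 1 + 2 * N / d) * norm (y - x)"
    proof (cases "norm (y - x) < d")
      case True
      have "\<bar>f y - f x\<bar> \<le> norm (df x) * norm (y - x) + norm (y - x)"
        using d(2)[OF y True] Cauchy_Schwarz_ineq2[of "df x" "y - x"] by linarith
      also have "\<dots> \<le> norm (df x) * norm (y - x) + norm (y - x) + 2 * N / d * norm (y - x)"
        using \<open>N \<ge> 0\<close> d(1) by simp
      finally show ?thesis
        by (simp add: algebra_simps)
    next
      case False
      have "\<bar>f y - f x\<bar> \<le> 2 * N"
        using N[OF y] N[OF assms(3)] by linarith
      also have "\<dots> = 2 * N / d * d"
        using d(1) by simp
      also have "\<dots> \<le> 2 * N / d * norm (y - x)"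
        using False \<open>N \<ge> 0\<close> d(1) by (intro mult_left_mono) auto
      also have "\<dots> \<le> (norm (df x) + 1 + 2 * N / d) * norm (y - x)"
        by (intro mult_right_mono) auto
      finally show ?thesis .
    qed
  qed
qed

section \<open>Uniform boundedness of difference quotients\<close>

text \<open>\<open>M\<close> is the norm of the functional sending \<open>f\<close> to
  \<open>f y - f x\<close>, finite because \<open>C1norm\<close> dominates the values of
  \<open>f\<close>. The supremum need not be attained; 3/4 is a choice above 1/2, the proportion
  that the tail of the later series can cancel.\<close>

lemma C1_increment_norming:
  assumes K: "compact K" and x: "x \<in> K" and y: "y \<in> K"
    and g: "g \<in> C1 K" and big: "D * C1norm K g < \<bar>g y - g x\<bar>"
  obtains M f where "D < M" "\<And>h. h \<in> C1 K \<Longrightarrow> \<bar>h y - h x\<bar> \<le> M * C1norm K h"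
    "f \<in> C1 K" "C1norm K f \<le> 1" "3/4 * M \<le> \<bar>f y - f x\<bar>"
proof -
  define S where "S = {\<bar>f y - f x\<bar> | f. f \<in> C1 K \<and> C1norm K f \<le> 1}"
  have bound: "\<bar>f y - f x\<bar> \<le> 2 * C1norm K f" if "f \<in> C1 K" for f
    using abs_le_C1norm[OF K that x] abs_le_C1norm[OF K that y] by linarith
  have bdd: "bdd_above S"
    unfolding S_def by (rule bdd_aboveI[of _ 2]) (use bound in fastforce)
  define M where "M = Sup S"
  have upper: "\<bar>f y - f x\<bar> \<le> M" if "f \<in> C1 K" "C1norm K f \<le> 1" for f
    unfolding M_def by (rule cSup_upper[OF _ bdd]) (use that S_def in blast)
  have scaled: "\<bar>h y - h x\<bar> \<le> M * C1norm K h" if h: "h \<in> C1 K" for h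
  \<comment> \<open>A function of seminorm 0 cannot be normalised, but then \<open>bound\<close>
    makes its increment vanish.\<close>
  proof (cases "C1norm K h = 0")
    case True
    then show ?thesis using bound[OF h] by simp
  next
    case False
    then have pos: "0 < C1norm K h"
      using C1norm_nonneg[OF K h] by simp
    have "C1norm K (\<lambda>z. (1 / C1norm K h) * h z) \<le> 1"
      using C1norm_scale_le[OF K h, of "1 / C1norm K h"] pos by simp
    then have "\<bar>(1 / C1norm K h) * h y - (1 / C1norm K h) * h x\<bar> \<le> M"
      using upper C1_scale[OF h] by blast
    moreover have "(1 / C1norm K h) * h y - (1 / C1norm K h) * h x = (h y - h x) / C1norm K h"
      by (simp add: diff_divide_distrib)
    ultimately show ?thesis
      using pos by (simp add: field_simps)
  qed
  have "0 \<le> M"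
    using upper[OF C1_zero] C1norm_le[OF K is_C1_deriv_zero, of 0 0] by simp
  have "D < M"
    using scaled[OF g] big C1norm_nonneg[OF K g]
    by (meson less_le_trans mult_right_less_imp_less)
  have "\<exists>f. f \<in> C1 K \<and> C1norm K f \<le> 1 \<and> 3/4 * M \<le> \<bar>f y - f x\<bar>"
  proof (cases "M = 0")
    case True
    then show ?thesis
      using C1_zero C1norm_le[OF K is_C1_deriv_zero, of 0 0] by (intro exI[of _ "\<lambda>z. 0"]) auto
  next
    case False
    have "S \<noteq> {}"
      unfolding S_def using C1_zero C1norm_le[OF K is_C1_deriv_zero, of 0 0] by fastforce
    moreover have "3/4 * M < Sup S"
      using False \<open>0 \<le> M\<close> unfolding M_def[symmetric] by simp
    ultimately obtain s where "s \<in> S" "3/4 * M < s"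
      using less_cSupD by blast
    then show ?thesis
      unfolding S_def by force
  qed
  then show thesis
    using that \<open>D < M\<close> scaled by blast
qed

text \<open>The uniform boundedness principle by Sokal's argument: signs are chosen in
  \<open>u = \<Sum>\<^sub>n \<plusminus>3\<^sup>-\<^sup>n f\<^sub>n\<close> so that the \<open>n\<close>-th partial sum does not
  lose the increment of \<open>f\<^sub>n\<close> at \<open>y\<^sub>n\<close>, and the tail is too small to cancel it.\<close>

lemma C1_complete_imp_uniform_increment_bound:
  fixes K :: "'a::euclidean_space set"
  assumes K: "compact K" and complete: "C1_complete K" and x: "x \<in> K"
  obtains C where "0 < C"
    "\<And>f y. f \<in> C1 K \<Longrightarrow> y \<in> K \<Longrightarrow> \<bar>f y - f x\<bar> \<le> C * norm (y - x) * C1norm K f"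
proof (rule ccontr)
  assume "\<not> thesis"
  then have unbounded: "\<exists>f y. f \<in> C1 K \<and> y \<in> K \<and> C * norm (y - x) * C1norm K f < \<bar>f y - f x\<bar>"
    if "0 < C" for C
    using that \<open>\<And>C. \<lbrakk>0 < C; \<And>f y. \<lbrakk>f \<in> C1 K; y \<in> K\<rbrakk> \<Longrightarrow> \<bar>f y - f x\<bar> \<le> C * norm (y - x) * C1norm K f\<rbrakk> \<Longrightarrow> thesis\<close>
    by (meson not_le)
  \<comment> \<open>Quotients beyond \<open>4 ^ n\<close> outgrow the weights
    \<open>1 / 3 ^ n\<close> of the series.\<close>
  have "\<exists>y M f. y \<in> K \<and> 4 ^ n * norm (y - x) < M \<and>
      (\<forall>h\<in>C1 K. \<bar>h y - h x\<bar> \<le> M * C1norm K h) \<and>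
      f \<in> C1 K \<and> C1norm K f \<le> 1 \<and> 3/4 * M \<le> \<bar>f y - f x\<bar>" for n :: nat
  proof -
    obtain g y where "g \<in> C1 K" "y \<in> K" "4 ^ n * norm (y - x) * C1norm K g < \<bar>g y - g x\<bar>"
      using unbounded[of "4 ^ n"] by auto
    then show ?thesis
      using C1_increment_norming[OF K x, of y g "4 ^ n * norm (y - x)"] by metis
  qed
  then obtain y M f where y: "\<And>n. y n \<in> K" and M: "\<And>n::nat. 4 ^ n * norm (y n - x) < M n"
    and bound: "\<And>n h. h \<in> C1 K \<Longrightarrow> \<bar>h (y n) - h x\<bar> \<le> M n * C1norm K h"
    and f: "\<And>n. f n \<in> C1 K" "\<And>n. C1norm K (f n) \<le> 1"
    and large: "\<And>n. 3/4 * M n \<le> \<bar>f n (y n) - f n x\<bar>"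
    by metis
  define pos where "pos v n \<longleftrightarrow> 0 \<le> (v (y n) - v x) * (f n (y n) - f n x)" for v n
  \<comment> \<open>Each sign depends on the partial sum built so far, hence a recursion instead of
    a closed sum.\<close>
  define u where "u = rec_nat (\<lambda>z. 0) (\<lambda>n v z. v z + (if pos v n then 1 else - 1) / 3 ^ n * f n z)"
  have u_Suc: "u (Suc n) = (\<lambda>z. u n z + (if pos (u n) n then 1 else - 1) / 3 ^ n * f n z)" for n
    unfolding u_def by simp
  have u_C1: "u n \<in> C1 K" for n
  proof (induction n)
    case 0
    then show ?case unfolding u_def using C1_zero by simp
  next
    case (Suc n)
    then show ?case unfolding u_Suc by (intro C1_add C1_scale f)
  qed
  have step: "C1norm K (\<lambda>z. u (Suc n) z - u n z) \<le> 1 / 3 ^ n" for n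
  proof -
    have "C1norm K (\<lambda>z. u (Suc n) z - u n z)
        \<le> \<bar>(if pos (u n) n then 1 else - 1) / 3 ^ n\<bar> * C1norm K (f n)"
      unfolding u_Suc add_diff_cancel_left' by (rule C1norm_scale_le[OF K f(1)])
    also have "\<dots> \<le> 1 / 3 ^ n * 1"
      using f(2) C1norm_nonneg[OF K f(1)] by (intro mult_mono) (auto simp: abs_if)
    finally show ?thesis by simp
  qed
  \<comment> \<open>The exact geometric remainder is kept so that the induction on \<open>k\<close>
    closes; \<open>tail'\<close> drops the second term.\<close>
  have tail: "C1norm K (\<lambda>z. u (n + k) z - u n z) \<le> 3/2 * (1 / 3 ^ n - 1 / 3 ^ (n + k))" for n k
  proof (induction k)
    case 0
    then show ?case using C1norm_le[OF K is_C1_deriv_zero, of 0 0] by simp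
  next
    case (Suc k)
    have "C1norm K (\<lambda>z. u (n + Suc k) z - u n z)
        \<le> C1norm K (\<lambda>z. u (Suc (n + k)) z - u (n + k) z) + C1norm K (\<lambda>z. u (n + k) z - u n z)"
      using C1norm_diff_triangle[OF K u_C1 u_C1 u_C1] by simp
    also have "\<dots> \<le> 1 / 3 ^ (n + k) + 3/2 * (1 / 3 ^ n - 1 / 3 ^ (n + k))"
      using step Suc.IH by (intro add_mono)
    also have "\<dots> = 3/2 * (1 / 3 ^ n - 1 / 3 ^ (n + Suc k))"
      by (simp add: field_simps)
    finally show ?case .
  qed
  have tail': "C1norm K (\<lambda>z. u m z - u n z) \<le> 3/2 * (1 / 3 ^ n)" if "n \<le> m" for m n
  proof -
    obtain k where k: "m = n + k"
      using \<open>n \<le> m\<close> le_Suc_ex by blast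
    have "3/2 * (1 / 3 ^ n - 1 / 3 ^ (n + k)) \<le> 3/2 * (1 / 3 ^ n :: real)"
      by (intro mult_left_mono) auto
    then show ?thesis
      unfolding k by (rule order_trans[OF tail])
  qed
  have "\<exists>N. \<forall>m\<ge>N. \<forall>n\<ge>N. C1norm K (\<lambda>z. u m z - u n z) < e" if "0 < e" for e
  proof -
    obtain N where "(1/3::real) ^ N < e / 3"
      using real_arch_pow_inv[of "e/3" "1/3"] \<open>0 < e\<close> by auto
    then have N: "3/2 * (1 / 3 ^ N) + 3/2 * (1 / 3 ^ N) < e"
      by (simp add: power_one_over field_simps)
    have "C1norm K (\<lambda>z. u m z - u n z) < e" if "m \<ge> N" "n \<ge> N" for m n
      using C1norm_diff_triangle[OF K u_C1[of m] u_C1[of N] u_C1[of n]]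
        C1norm_minus_commute[OF K u_C1[of N] u_C1[of n]] tail'[OF that(1)] tail'[OF that(2)] N
      by linarith
    then show ?thesis by blast
  qed
  then obtain v where v: "v \<in> C1 K" and lim: "(\<lambda>n. C1norm K (\<lambda>z. u n z - v z)) \<longlonglongrightarrow> 0"
    using complete u_C1 unfolding C1_complete_def by blast
  have dist_v: "C1norm K (\<lambda>z. v z - u n z) \<le> 3/2 * (1 / 3 ^ n)" for n
  proof (rule field_le_epsilon)
    fix e :: real assume "0 < e"
    then have "\<forall>\<^sub>F m in sequentially. C1norm K (\<lambda>z. u m z - v z) < e"
      using lim order_tendstoD(2) by blast
    then obtain N where "\<And>m. m \<ge> N \<Longrightarrow> C1norm K (\<lambda>z. u m z - v z) < e"
      unfolding eventually_sequentially by blast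
    then obtain m where "m \<ge> n" "C1norm K (\<lambda>z. u m z - v z) < e"
      using max.cobounded1[of n N] max.cobounded2[of N n] by blast
    then show "C1norm K (\<lambda>z. v z - u n z) \<le> 3/2 * (1 / 3 ^ n) + e"
      using C1norm_diff_triangle[OF K v u_C1[of m] u_C1[of n]] tail'[of n m]
        C1norm_minus_commute[OF K v u_C1[of m]] by linarith
  qed
  obtain B where B: "\<And>z. z \<in> K \<Longrightarrow> \<bar>v z - v x\<bar> \<le> B * norm (z - x)"
    using C1_pointwise_lipschitz[OF K v x] by blast
  \<comment> \<open>The partial sum through term \<open>n\<close> has increment at least
    \<open>3/4 * M n / 3 ^ n\<close>, and the remainder of the series costs at most half of
    \<open>M n / 3 ^ n\<close>. The surviving quarter contradicts the Lipschitz bound of the limit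
    at \<open>x\<close> for large \<open>n\<close>.\<close>
  have "(4/3) ^ n \<le> 4 * B" for n :: nat
  proof -
    define w where "w = u (Suc n)"
    have "\<bar>f n (y n) - f n x\<bar> / 3 ^ n \<le> \<bar>w (y n) - w x\<bar>"
    proof -
      have *: "w (y n) - w x = (u n (y n) - u n x)
          + (if pos (u n) n then 1 else - 1) * ((f n (y n) - f n x) / 3 ^ n)"
        unfolding w_def u_Suc by (simp add: algebra_simps diff_divide_distrib)
      have eq: "0 \<le> (u n (y n) - u n x) * ((f n (y n) - f n x) / 3 ^ n) \<longleftrightarrow> pos (u n) n"
        using pos_le_divide_eq[of "3 ^ n" 0 "(u n (y n) - u n x) * (f n (y n) - f n x)"]
        unfolding pos_def by (simp only: times_divide_eq_right mult_zero_left zero_less_power zero_less_numeral)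
      have "\<bar>F\<bar> \<le> \<bar>A + (if 0 \<le> A * F then 1 else - 1) * F\<bar>" for A F :: real
        by (cases "0 \<le> A"; cases "0 \<le> F") (auto simp: zero_le_mult_iff)
      from this[of "(f n (y n) - f n x) / 3 ^ n" "u n (y n) - u n x"]
      have "\<bar>(f n (y n) - f n x) / 3 ^ n\<bar> \<le> \<bar>w (y n) - w x\<bar>"
        unfolding * eq .
      then show ?thesis by simp
    qed
    then have "3/4 * M n / 3 ^ n \<le> \<bar>w (y n) - w x\<bar>"
      using large[of n] by (meson divide_right_mono order_trans zero_le_numeral zero_le_power)
    moreover have "\<bar>(v (y n) - w (y n)) - (v x - w x)\<bar> \<le> M n * (3/2 * (1 / 3 ^ Suc n))"
    proof -
      have "0 \<le> M n"
        using M[of n] by (meson less_imp_le mult_nonneg_nonneg norm_ge_zero order_trans zero_le_numeral zero_le_power)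
      then show ?thesis
        using bound[OF C1_diff[OF v u_C1], of n "Suc n"] dist_v[of "Suc n"] unfolding w_def
        by (meson mult_left_mono order_trans)
    qed
    moreover have "M n * (3/2 * (1 / 3 ^ Suc n)) = M n / 2 / 3 ^ n"
      by simp
    ultimately have "3/4 * M n / 3 ^ n - M n / 2 / 3 ^ n \<le> \<bar>v (y n) - v x\<bar>"
      by linarith
    moreover have "3/4 * M n / 3 ^ n - M n / 2 / 3 ^ n = M n / (4 * 3 ^ n)"
      by (simp add: field_simps)
    ultimately have "M n / (4 * 3 ^ n) \<le> B * norm (y n - x)"
      using B[OF y, of n] by linarith
    then have "M n \<le> 4 * B * 3 ^ n * norm (y n - x)"
      by (simp add: field_simps)
    then have "4 ^ n * norm (y n - x) < 4 * B * 3 ^ n * norm (y n - x)"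
      using M[of n] by linarith
    then have "4 ^ n < 4 * B * 3 ^ n"
      by (rule mult_right_less_imp_less) simp
    then show ?thesis
      by (simp add: power_divide field_simps)
  qed
  then show False
    using real_arch_pow[of "4/3" "4 * B"] by (simp add: not_less[symmetric])
qed

section \<open>Smoothing locally Lipschitz functions\<close>

text \<open>This is log-sum-exp smoothing of the minimum over \<open>p\<close> of
  \<open>f p + c * |y - p|\<^sup>2\<close>. Differentiating the logarithm divides the exponentials
  by their sum, so the gradients \<open>2 * c * (y - p)\<close> are averaged with softmax weights.
  Only the values of \<open>f\<close> on \<open>P\<close> enter, as constants.\<close>

lemma is_C1_deriv_softmin:
  fixes K :: "'a::euclidean_space set" and f :: "'a \<Rightarrow> real" and c :: real
  assumes P: "finite P" "P \<noteq> {}" and \<tau>: "0 < \<tau>"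
  defines "E \<equiv> \<lambda>p y. exp (- (f p + c * ((y - p) \<bullet> (y - p))) / \<tau>)"
  shows "is_C1_deriv K (\<lambda>y. - \<tau> * ln (\<Sum>p\<in>P. E p y))
           (\<lambda>y. \<Sum>p\<in>P. (E p y / (\<Sum>p\<in>P. E p y)) *\<^sub>R ((2 * c) *\<^sub>R (y - p)))"
proof -
  have pos: "0 < (\<Sum>p\<in>P. E p y)" for y
    using P unfolding E_def by (intro sum_pos) auto
  have dE: "(E p has_derivative (\<lambda>h. E p y * (- (2 * c * ((y - p) \<bullet> h)) / \<tau>))) (at y within K)" for p y
    unfolding E_def
    by (auto intro!: derivative_eq_intros simp: \<tau>[THEN less_imp_neq, symmetric] inner_commute field_simps)
  have "((\<lambda>y. \<Sum>p\<in>P. E p y) has_derivative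
      (\<lambda>h. \<Sum>p\<in>P. E p y * (- (2 * c * ((y - p) \<bullet> h)) / \<tau>))) (at y within K)" for y
    by (rule has_derivative_sum) (rule dE)
  then have "((\<lambda>y. ln (\<Sum>p\<in>P. E p y)) has_derivative
      (\<lambda>h. (\<Sum>p\<in>P. E p y * (- (2 * c * ((y - p) \<bullet> h)) / \<tau>)) * inverse (\<Sum>p\<in>P. E p y)))
      (at y within K)" for y
    by (rule has_derivative_ln[rotated]) (rule pos)
  then have D: "((\<lambda>y. - \<tau> * ln (\<Sum>p\<in>P. E p y)) has_derivative
      (\<lambda>h. - \<tau> * ((\<Sum>p\<in>P. E p y * (- (2 * c * ((y - p) \<bullet> h)) / \<tau>)) * inverse (\<Sum>p\<in>P. E p y))))
      (at y within K)" for y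
    by (rule has_derivative_mult_right)
  have eq: "- \<tau> * ((\<Sum>p\<in>P. E p y * (- (2 * c * ((y - p) \<bullet> h)) / \<tau>)) * inverse (\<Sum>p\<in>P. E p y))
      = (\<Sum>p\<in>P. (E p y / (\<Sum>p\<in>P. E p y)) *\<^sub>R ((2 * c) *\<^sub>R (y - p))) \<bullet> h" for y h
    unfolding inner_sum_left inner_scaleR_left sum_distrib_right sum_distrib_left
    by (rule sum.cong) (use \<tau> in \<open>auto simp: field_simps\<close>)
  have contE: "continuous_on K (E p)" for p
    unfolding E_def using \<tau> by (intro continuous_intros) auto
  have "continuous_on K (\<lambda>y. \<Sum>p\<in>P. (E p y / (\<Sum>p\<in>P. E p y)) *\<^sub>R ((2 * c) *\<^sub>R (y - p)))"
    using pos by (intro continuous_intros contE) (metis less_irrefl)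
  moreover have "((\<lambda>y. - \<tau> * ln (\<Sum>p\<in>P. E p y)) has_derivative
      inner (\<Sum>p\<in>P. (E p y / (\<Sum>p\<in>P. E p y)) *\<^sub>R ((2 * c) *\<^sub>R (y - p)))) (at y within K)" for y
    by (rule has_derivative_eq_rhs[OF D]) (use eq in blast)
  ultimately show ?thesis
    unfolding is_C1_deriv_iff_has_derivative by blast
qed

text \<open>The gradient of a soft minimum of functions is a convex combination of their gradients, so
  no bound on the overlap of a partition of unity is needed. For the quadratics
  \<open>f p + c |y - p|\<^sup>2\<close> the weight concentrates on points \<open>p\<close> at distance at most
  \<open>3 / c\<close>, where the gradients are bounded by \<open>6\<close>.\<close>

lemma C1_approximation_locally_lipschitz:
  fixes K :: "'a::euclidean_space set" and f :: "'a \<Rightarrow> real"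
  assumes K: "compact K" and \<epsilon>: "0 < \<epsilon>" and \<delta>: "0 < \<delta>" "\<delta> \<le> 1"
    and range: "\<And>y. y \<in> K \<Longrightarrow> 0 \<le> f y \<and> f y \<le> 1"
    and lip: "\<And>y z. y \<in> K \<Longrightarrow> z \<in> K \<Longrightarrow> norm (y - z) < \<epsilon> \<Longrightarrow> \<bar>f y - f z\<bar> \<le> norm (y - z)"
  obtains F where "F \<in> C1 K" "C1norm K F \<le> 9" "\<And>y. y \<in> K \<Longrightarrow> \<bar>F y - f y\<bar> \<le> \<delta>"
proof (cases "K = {}")
  case True
  then show thesis
    using that[of "\<lambda>y. 0"] C1_zero[of K] C1norm_le[OF K is_C1_deriv_zero, of 0 0] by simp
next
  case False
  obtain D0 where "\<And>y z. y \<in> K \<Longrightarrow> z \<in> K \<Longrightarrow> norm (y - z) \<le> D0"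
    using compact_imp_bounded[OF K] unfolding bounded_two_points dist_norm by blast
  then obtain D where D: "0 < D" "\<And>y z. y \<in> K \<Longrightarrow> z \<in> K \<Longrightarrow> norm (y - z) \<le> D"
    by (meson max.cobounded1 max.coboundedI2 less_le_trans zero_less_one)
  \<comment> \<open>\<open>2 / \<epsilon>\<^sup>2\<close> makes half of the penalty reach 1, the
    upper bound of \<open>f\<close>, at distances \<epsilon> and more, where \<open>lip\<close> is
    silent; \<open>1 / \<delta>\<close> makes the error \<open>1 / (2 * c)\<close> at most
    \<open>\<delta> / 2\<close>.\<close>
  define c where "c = max (2 / \<epsilon>\<^sup>2) (1 / \<delta>)"
  have "2 / \<epsilon>\<^sup>2 \<le> c" "1 / \<delta> \<le> c"
    unfolding c_def by auto
  then have c: "0 < c" "2 \<le> c * \<epsilon>\<^sup>2" "1 \<le> c * \<delta>"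
    using \<epsilon> \<delta> less_le_trans[of 0 "1 / \<delta>" c] by (simp_all add: pos_divide_le_eq)
  \<comment> \<open>The mesh of a net: below \<epsilon> for \<open>lip\<close>, and so small that
    the nearest quadratic exceeds \<open>f y\<close> by at most
    \<open>2 * \<eta> \<le> 1 / (2 * c)\<close>.\<close>
  define \<eta> where "\<eta> = min (\<epsilon> / 2) (1 / (4 * c))"
  have \<eta>: "0 < \<eta>" "\<eta> < \<epsilon>" "4 * c * \<eta> \<le> 1"
  proof -
    show "0 < \<eta>" "\<eta> < \<epsilon>"
      unfolding \<eta>_def using \<epsilon> c(1) by auto
    have "\<eta> \<le> 1 / (4 * c)"
      unfolding \<eta>_def by simp
    then show "4 * c * \<eta> \<le> 1"
      using c(1) by (simp add: field_simps)
  qed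
  obtain P where P: "finite P" "P \<subseteq> K" "K \<subseteq> (\<Union>p\<in>P. ball p \<eta>)"
    using compactE_image[OF K, of K "\<lambda>p. ball p \<eta>"] \<eta>(1) by (metis centre_in_ball open_ball subsetI UN_I)
  then have "P \<noteq> {}" using False by auto
  define N where "N = real (card P)"
  have N: "1 \<le> N"
    unfolding N_def using P(1) \<open>P \<noteq> {}\<close> by (simp add: Suc_leI card_gt_0_iff)
  \<comment> \<open>The first entry controls the smoothing error
    \<open>\<tau> * ln N \<le> \<tau> * N\<close>; the second makes each distant point contribute at
    most \<open>1 / N\<close> to the gradient, hence at most 1 altogether.\<close>
  define \<tau> where "\<tau> = min (\<delta> / (2 * N)) (1 / (4 * c\<^sup>2 * N * D))"
  have \<tau>: "0 < \<tau>" "2 * N * \<tau> \<le> \<delta>" "4 * c\<^sup>2 * N * D * \<tau> \<le> 1"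
  proof -
    show "0 < \<tau>"
      unfolding \<tau>_def using N D(1) c(1) \<delta> by simp
    have "\<tau> \<le> \<delta> / (2 * N)" "\<tau> \<le> 1 / (4 * c\<^sup>2 * N * D)"
      unfolding \<tau>_def by simp_all
    moreover have "0 < 4 * c\<^sup>2 * N * D" "0 < 2 * N"
      using N D(1) c(1) by auto
    ultimately show "2 * N * \<tau> \<le> \<delta>" "4 * c\<^sup>2 * N * D * \<tau> \<le> 1"
      by (simp_all only: pos_le_divide_eq mult.commute)
  qed
  define a where "a p y = f p + c * ((y - p) \<bullet> (y - p))" for p y
  define E where "E p y = exp (- a p y / \<tau>)" for p y
  define S where "S y = (\<Sum>p\<in>P. E p y)" for y
  define F where "F y = - \<tau> * ln (S y)" for y
  define dF where "dF y = (\<Sum>p\<in>P. (E p y / S y) *\<^sub>R ((2 * c) *\<^sub>R (y - p)))" for y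
  have deriv: "is_C1_deriv K F dF"
    using is_C1_deriv_softmin[OF P(1) \<open>P \<noteq> {}\<close> \<tau>(1), of K f c]
    unfolding F_def[abs_def] dF_def[abs_def] S_def E_def a_def by (simp only: mult.assoc)
  have S_pos: "0 < S y" for y
    unfolding S_def E_def using P(1) \<open>P \<noteq> {}\<close> by (intro sum_pos) auto
  have near: "\<exists>q\<in>P. a q y \<le> f y + 1 / (2 * c)" if y: "y \<in> K" for y
  proof -
    obtain q where q: "q \<in> P" "norm (y - q) < \<eta>"
      using P(3) y by (auto simp: dist_norm norm_minus_commute)
    have "f q \<le> f y + \<eta>"
      using lip[of y q] q \<eta> y P(2) by (smt (verit) subset_eq)
    moreover have "c * ((y - q) \<bullet> (y - q)) \<le> c * (\<eta> * \<eta>)"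
      unfolding dot_square_norm power2_eq_square using q(2) c(1) \<eta>(1)
      by (intro mult_left_mono mult_mono) auto
    moreover have "c * (\<eta> * \<eta>) \<le> \<eta>"
      using mult_right_mono[of "c * \<eta>" 1 \<eta>] \<eta> c(1) by (simp add: mult.assoc)
    moreover have "2 * \<eta> \<le> 1 / (2 * c)"
      using \<eta>(3) c(1) by (simp add: field_simps)
    ultimately have "a q y \<le> f y + 1 / (2 * c)"
      unfolding a_def by linarith
    then show ?thesis using q(1) by blast
  qed
  \<comment> \<open>Half of the penalty survives in both regimes: within \<epsilon> the other half
    is dropped, beyond \<epsilon> it dominates \<open>f y \<le> 1\<close>.\<close>
  have lower: "f y + c / 2 * (norm (y - p))\<^sup>2 - norm (y - p) \<le> a p y" if y: "y \<in> K" and p: "p \<in> P" for y p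
  proof (cases "norm (y - p) < \<epsilon>")
    case True
    then have "f y - norm (y - p) \<le> f p"
      using lip[of y p] y p P(2) by (smt (verit) subset_eq)
    moreover have "c / 2 * (norm (y - p))\<^sup>2 \<le> c * (norm (y - p))\<^sup>2"
      using c(1) by (intro mult_right_mono) auto
    ultimately show ?thesis
      unfolding a_def dot_square_norm by linarith
  next
    case False
    then have "c * \<epsilon>\<^sup>2 \<le> c * (norm (y - p))\<^sup>2"
      using \<epsilon> c(1) by (intro mult_left_mono power_mono) auto
    then have "f y \<le> c / 2 * (norm (y - p))\<^sup>2"
      using c(2) range[OF y] by simp
    moreover have "0 \<le> f p"
      using range p P(2) by blast
    ultimately show ?thesis
      unfolding a_def dot_square_norm using norm_ge_zero[of "y - p"] by linarith
  qed
  have S_ge: "E q y \<le> S y" if "q \<in> P" for q y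
    unfolding S_def using P(1) that by (intro member_le_sum) (auto simp: E_def)
  have F_le: "F y \<le> a q y" if "q \<in> P" for q y
  proof -
    have "- a q y / \<tau> \<le> ln (S y)"
      using S_ge[OF that, of y] S_pos[of y] unfolding E_def by (metis exp_gt_zero ln_exp ln_le_cancel_iff)
    then show ?thesis
      unfolding F_def using \<tau>(1) by (simp add: field_simps)
  qed
  have F_ge: "f y - \<delta> \<le> F y" if y: "y \<in> K" for y
  proof -
    have "E p y \<le> exp (- (f y - 1 / (2 * c)) / \<tau>)" if p: "p \<in> P" for p
    proof -
      \<comment> \<open>Completing the square: \<open>c / 2 * r\<^sup>2 - r\<close> is minimal at
        \<open>r = 1 / c\<close>, with value \<open>- 1 / (2 * c)\<close>.\<close>
      have "0 \<le> c / 2 * (norm (y - p) - 1 / c)\<^sup>2"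
        using c(1) by simp
      also have "\<dots> = c / 2 * (norm (y - p))\<^sup>2 - norm (y - p) + 1 / (2 * c)"
        using c(1) by (simp add: power2_eq_square field_simps)
      finally have "f y - 1 / (2 * c) \<le> a p y"
        using lower[OF y p] by linarith
      then show ?thesis
        unfolding E_def exp_le_cancel_iff using \<tau>(1) by (intro divide_right_mono) auto
    qed
    then have "S y \<le> N * exp (- (f y - 1 / (2 * c)) / \<tau>)"
      unfolding S_def N_def by (rule sum_bounded_above)
    then have "ln (S y) \<le> ln (N * exp (- (f y - 1 / (2 * c)) / \<tau>))"
      using S_pos[of y] N by (simp add: ln_mono)
    also have "\<dots> = ln N - (f y - 1 / (2 * c)) / \<tau>"
      using N by (simp add: ln_mult minus_divide_left)
    also have "\<dots> \<le> N - (f y - 1 / (2 * c)) / \<tau>"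
      using ln_le_minus_one[of N] N by linarith
    finally have "\<tau> * ln (S y) \<le> \<tau> * (N - (f y - 1 / (2 * c)) / \<tau>)"
      using \<tau>(1) by simp
    also have "\<dots> = N * \<tau> - (f y - 1 / (2 * c))"
      using \<tau>(1) by (simp add: field_simps)
    finally have "f y - 1 / (2 * c) - N * \<tau> \<le> F y"
      unfolding F_def by linarith
    moreover have "1 / (2 * c) \<le> \<delta> / 2"
      using c by (simp add: field_simps)
    ultimately show ?thesis
      using \<tau>(2) by linarith
  qed
  have close: "\<bar>F y - f y\<bar> \<le> \<delta>" if y: "y \<in> K" for y
  proof -
    obtain q where "q \<in> P" "a q y \<le> f y + 1 / (2 * c)"
      using near[OF y] by blast
    moreover have "1 / (2 * c) \<le> \<delta>"
      using c by (simp add: field_simps)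
    ultimately show ?thesis
      using F_le[of q y] F_ge[OF y] by linarith
  qed
  have grad: "norm (dF y) \<le> 7" if y: "y \<in> K" for y
  proof -
    obtain q where q: "q \<in> P" "a q y \<le> f y + 1 / (2 * c)"
      using near[OF y] by blast
    have term_le: "norm ((E p y / S y) *\<^sub>R ((2 * c) *\<^sub>R (y - p))) \<le> (E p y / S y) * 6 + 1 / N"
      if p: "p \<in> P" for p
    proof -
      have norm_eq: "norm ((E p y / S y) *\<^sub>R ((2 * c) *\<^sub>R (y - p)))
          = (E p y / S y) * (2 * c * norm (y - p))"
        using S_pos[of y] c(1) by (simp add: E_def)
      have E_nonneg: "0 \<le> E p y / S y"
        using S_pos[of y] by (simp add: E_def)
      show ?thesis
      proof (cases "norm (y - p) \<le> 3 / c")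
        case True
        then have "2 * c * norm (y - p) \<le> 6"
          using c(1) by (simp add: field_simps)
        then have "(E p y / S y) * (2 * c * norm (y - p)) \<le> (E p y / S y) * 6"
          using E_nonneg by (intro mult_left_mono) auto
        moreover have "0 \<le> 1 / N"
          using N by simp
        ultimately show ?thesis
          unfolding norm_eq by (intro add_increasing2)
      next
        case False
        \<comment> \<open>Beyond \<open>3 / c\<close> the bound \<open>lower\<close> exceeds
          \<open>f y + 1 / c\<close>, hence lies at least \<open>1 / (2 * c)\<close> above
          \<open>a q y\<close>. With \<open>exp t \<ge> t\<close> the weight of \<open>p\<close> is
          then at most \<open>2 * c * \<tau>\<close>.\<close>
        have "3 * (1 / c) < norm (y - p)"
          using False by simp
        have "3 \<le> c * norm (y - p)"
          using False c(1) by (simp add: field_simps)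
        then have "0 \<le> (c * norm (y - p) - 3) * norm (y - p)"
          by (intro mult_nonneg_nonneg) auto
        then have "3 * norm (y - p) \<le> c * (norm (y - p))\<^sup>2"
          by (simp add: power2_eq_square algebra_simps)
        then have "1 / c \<le> c / 2 * (norm (y - p))\<^sup>2 - norm (y - p)"
          using \<open>3 * (1 / c) < norm (y - p)\<close> zero_less_divide_1_iff[of c] c(1) by linarith
        then have "1 / (2 * c) \<le> a p y - a q y"
          using lower[OF y p] q(2) divide_divide_eq_left[of 1 c 2] by (simp add: mult.commute)
        then have "1 / (2 * c) / \<tau> \<le> (a p y - a q y) / \<tau>"
          using \<tau>(1) by (intro divide_right_mono) auto
        have "E p y / S y \<le> E p y / E q y"
          using S_ge[OF q(1), of y] S_pos[of y] by (intro divide_left_mono) (auto simp: E_def)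
        also have "\<dots> = 1 / exp ((a p y - a q y) / \<tau>)"
          unfolding E_def by (simp add: exp_diff exp_minus diff_divide_distrib field_simps)
        also have "\<dots> \<le> 1 / (1 / (2 * c) / \<tau>)"
        proof (rule divide_left_mono)
          show "1 / (2 * c) / \<tau> \<le> exp ((a p y - a q y) / \<tau>)"
            using \<open>1 / (2 * c) / \<tau> \<le> (a p y - a q y) / \<tau>\<close> exp_ge_add_one_self[of "(a p y - a q y) / \<tau>"]
            by linarith
        qed (use c(1) \<tau>(1) in auto)
        also have "\<dots> = 2 * c * \<tau>"
          by simp
        finally have "(E p y / S y) * (2 * c * norm (y - p)) \<le> (2 * c * \<tau>) * (2 * c * D)"
          using D y p P(2) c(1) \<tau>(1) by (intro mult_mono) auto
        also have "\<dots> = (4 * c\<^sup>2 * N * D * \<tau>) / N"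
          using N by (simp add: power2_eq_square)
        also have "\<dots> \<le> 1 / N"
          using \<tau>(3) N by (intro divide_right_mono) auto
        finally show ?thesis
          unfolding norm_eq using E_nonneg by (intro add_increasing mult_nonneg_nonneg) auto
      qed
    qed
    have "norm (dF y) \<le> (\<Sum>p\<in>P. (E p y / S y) * 6 + 1 / N)"
      unfolding dF_def using term_le by (rule sum_norm_le)
    also have "\<dots> = (\<Sum>p\<in>P. E p y) / S y * 6 + N * (1 / N)"
      unfolding N_def by (simp add: sum.distrib sum_distrib_right sum_divide_distrib)
    also have "\<dots> = 7"
      using S_pos[of y] N unfolding S_def[symmetric] by simp
    finally show ?thesis .
  qed
  have "\<bar>F y\<bar> \<le> 2" if "y \<in> K" for y
    using close[OF that] range[OF that] \<delta> by linarith
  then have "C1norm K F \<le> 2 + 7"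
    using grad by (intro C1norm_le[OF K deriv]) auto
  then show thesis
    using that[of F] deriv close unfolding C1_def by auto
qed

section \<open>From chains to rectifiable paths\<close>

inductive chain :: "real \<Rightarrow> 'a::metric_space set \<Rightarrow> 'a \<Rightarrow> real \<Rightarrow> 'a \<Rightarrow> bool"
  for \<epsilon> K x where
  chain_refl: "x \<in> K \<Longrightarrow> chain \<epsilon> K x 0 x"
| chain_step: "chain \<epsilon> K x l y \<Longrightarrow> z \<in> K \<Longrightarrow> dist y z < \<epsilon> \<Longrightarrow> chain \<epsilon> K x (l + dist y z) z"

lemma chain_length_nonneg: "chain \<epsilon> K x l y \<Longrightarrow> 0 \<le> l"
  by (induction rule: chain.induct) auto

lemma chain_end_mem: "chain \<epsilon> K x l y \<Longrightarrow> y \<in> K"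
  by (induction rule: chain.induct) auto

text \<open>Inserting 1 gives a value to points that no chain from \<open>x\<close> reaches, and
  yields the range from 0 to 1 that the smoothing requires.\<close>

definition chain_dist :: "real \<Rightarrow> 'a::metric_space set \<Rightarrow> 'a \<Rightarrow> 'a \<Rightarrow> real" where
  "chain_dist \<epsilon> K x y = Inf (insert 1 {l. chain \<epsilon> K x l y})"

lemma chain_lengths_bdd_below: "bdd_below (insert 1 {l. chain \<epsilon> K x l y})"
  by (rule bdd_belowI[of _ 0]) (auto simp: chain_length_nonneg)

lemma chain_dist_bounds: "0 \<le> chain_dist \<epsilon> K x y" "chain_dist \<epsilon> K x y \<le> 1"
  unfolding chain_dist_def
  by (auto intro!: cInf_greatest cInf_lower chain_lengths_bdd_below simp: chain_length_nonneg)

lemma chain_dist_le: "chain \<epsilon> K x l y \<Longrightarrow> chain_dist \<epsilon> K x y \<le> l"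
  unfolding chain_dist_def by (auto intro!: cInf_lower chain_lengths_bdd_below)

lemma chain_dist_refl: "x \<in> K \<Longrightarrow> chain_dist \<epsilon> K x x = 0"
  using chain_dist_le[OF chain_refl] chain_dist_bounds(1) by (metis order_antisym)

lemma chain_dist_step:
  assumes "z \<in> K" "dist y z < \<epsilon>"
  shows "chain_dist \<epsilon> K x z \<le> chain_dist \<epsilon> K x y + dist y z"
proof -
  have "chain_dist \<epsilon> K x z - dist y z \<le> s" if "s \<in> insert 1 {l. chain \<epsilon> K x l y}" for s
  proof (cases "chain \<epsilon> K x s y")
    case True
    then show ?thesis
      using chain_dist_le[OF chain_step[OF _ assms]] by (simp add: algebra_simps)
  next
    case False
    then have "s = 1"
      using that by simp
    then show ?thesis
      using chain_dist_bounds(2)[of \<epsilon> K x z] zero_le_dist[of y z] by linarith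
  qed
  then have "chain_dist \<epsilon> K x z - dist y z \<le> chain_dist \<epsilon> K x y"
    unfolding chain_dist_def[of \<epsilon> K x y] by (intro cInf_greatest) auto
  then show ?thesis by simp
qed

text \<open>Appending an admissible step is possible in both directions, so the constant is 1
  whatever \<epsilon> and the shape of \<open>K\<close>.\<close>

lemma chain_dist_lipschitz:
  assumes "y \<in> K" "z \<in> K" "dist y z < \<epsilon>"
  shows "\<bar>chain_dist \<epsilon> K x y - chain_dist \<epsilon> K x z\<bar> \<le> dist y z"
  using chain_dist_step[OF assms(2,3), of x] chain_dist_step[OF assms(1), of z \<epsilon> x] assms(3)
  by (simp add: dist_commute abs_le_iff)

text \<open>The polygon is parametrised by arc length, each step appending a segment of unit speed.
  Points of the segment are closer than \<epsilon> to its starting vertex, which lies in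
  \<open>K\<close>.\<close>

lemma chain_polygon:
  fixes x :: "'a::real_normed_vector"
  assumes "chain \<epsilon> K x l y" "0 < \<epsilon>"
  shows "\<exists>\<gamma>. 1-lipschitz_on {0..l} \<gamma> \<and> \<gamma> 0 = x \<and> \<gamma> l = y \<and> (\<forall>t\<in>{0..l}. \<exists>k\<in>K. dist (\<gamma> t) k < \<epsilon>)"
  using assms
proof (induction rule: chain.induct)
  case chain_refl
  then show ?case
    by (intro exI[of _ "\<lambda>t. x"]) (auto intro!: lipschitz_onI bexI[of _ x])
next
  case (chain_step l y z)
  then obtain \<gamma> where \<gamma>: "1-lipschitz_on {0..l} \<gamma>" "\<gamma> 0 = x" "\<gamma> l = y"
    "\<And>t. t \<in> {0..l} \<Longrightarrow> \<exists>k\<in>K. dist (\<gamma> t) k < \<epsilon>"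
    by blast
  have l: "0 \<le> l" and y: "y \<in> K"
    using chain_step.hyps(1) chain_length_nonneg chain_end_mem by blast+
  define d where "d = dist y z"
  show ?case
  proof (cases "d = 0")
    case True
    then show ?thesis using \<gamma> unfolding d_def by auto
  next
    case False
    then have d: "0 < d" "d = norm (z - y)"
      unfolding d_def by (auto simp: dist_norm norm_minus_commute)
    define g where "g t = y + ((t - l) / d) *\<^sub>R (z - y)" for t
    have g_dist: "dist (g s) (g t) = \<bar>s - t\<bar>" for s t
    proof -
      have "g s - g t = ((s - t) / d) *\<^sub>R (z - y)"
        unfolding g_def by (simp add: scaleR_diff_left[symmetric] diff_divide_distrib)
      then show ?thesis
        using d by (simp add: dist_norm)
    qed
    have "1-lipschitz_on {l..l + d} g"
      by (rule lipschitz_onI) (auto simp: g_dist dist_real_def)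
    moreover have "\<gamma> l = g l"
      using \<gamma>(3) by (simp add: g_def)
    ultimately have "1-lipschitz_on {0..l + d} (\<lambda>t. if t \<le> l then \<gamma> t else g t)"
      using \<gamma>(1) lipschitz_on_concat by blast
    moreover have "\<exists>k\<in>K. dist (if t \<le> l then \<gamma> t else g t) k < \<epsilon>" if t: "t \<in> {0..l + d}" for t
    proof (cases "t \<le> l")
      case True
      then show ?thesis using \<gamma>(4) t by auto
    next
      case False
      have "dist (g t) y = \<bar>t - l\<bar>"
        using g_dist[of t l] by (simp add: g_def)
      also have "\<dots> < \<epsilon>"
        using False t chain_step.hyps(3) unfolding d_def by auto
      finally show ?thesis
        using False y by auto
    qed
    ultimately show ?thesis
      using \<gamma>(2,3) l d unfolding d_def[symmetric]
      by (intro exI[of _ "\<lambda>t. if t \<le> l then \<gamma> t else g t"]) (auto simp: g_def)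
  qed
qed

text \<open>The polygons stay within \<open>1 / (n + 1)\<close> of \<open>K\<close>, so their limit
  lies in the closed set \<open>K\<close>. The common Lipschitz constant supplies equicontinuity and
  passes to the limit, where it bounds the length by \<open>L\<close>.\<close>

lemma lipschitz_path_of_chains:
  fixes K :: "'a::euclidean_space set"
  assumes K: "compact K" and L: "0 \<le> L"
    and chains: "\<And>\<epsilon>. 0 < \<epsilon> \<Longrightarrow> \<exists>l\<le>L. chain \<epsilon> K x l y"
  obtains \<gamma> where "1-lipschitz_on {0..L} \<gamma>" "\<gamma> 0 = x" "\<gamma> L = y" "\<gamma> ` {0..L} \<subseteq> K"
proof -
  have "\<exists>\<gamma>. 1-lipschitz_on {0..L} \<gamma> \<and> \<gamma> 0 = x \<and> \<gamma> L = y \<and>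
      (\<forall>t\<in>{0..L}. \<exists>k\<in>K. dist (\<gamma> t) k < inverse (real (Suc n)))" for n
  proof -
    have pos: "0 < inverse (real (Suc n))" by simp
    obtain l where l: "l \<le> L" "chain (inverse (real (Suc n))) K x l y"
      using chains[OF pos] by blast
    obtain \<gamma> where \<gamma>: "1-lipschitz_on {0..l} \<gamma>" "\<gamma> 0 = x" "\<gamma> l = y"
      "\<And>t. t \<in> {0..l} \<Longrightarrow> \<exists>k\<in>K. dist (\<gamma> t) k < inverse (real (Suc n))"
      using chain_polygon[OF l(2) pos] by blast
    have "0 \<le> l"
      using chain_length_nonneg[OF l(2)] .
    \<comment> \<open>Waiting at \<open>y\<close> after time \<open>l\<close> puts polygons of
      different lengths on one common interval.\<close>
    have "1-lipschitz_on {0..L} (\<lambda>t. \<gamma> (min t l))"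
    proof (rule lipschitz_onI)
      fix s t assume "s \<in> {0..L}" "t \<in> {0..L}"
      then have "dist (\<gamma> (min s l)) (\<gamma> (min t l)) \<le> 1 * dist (min s l) (min t l)"
        using \<open>0 \<le> l\<close> by (intro lipschitz_onD[OF \<gamma>(1)]) auto
      also have "\<dots> \<le> 1 * dist s t"
        by (auto simp: dist_real_def min_def)
      finally show "dist (\<gamma> (min s l)) (\<gamma> (min t l)) \<le> 1 * dist s t" .
    qed simp
    moreover have "\<exists>k\<in>K. dist (\<gamma> (min t l)) k < inverse (real (Suc n))" if "t \<in> {0..L}" for t
      using that \<open>0 \<le> l\<close> by (intro \<gamma>(4)) auto
    ultimately show ?thesis
      using \<gamma>(2,3) l(1) \<open>0 \<le> l\<close> by (intro exI[of _ "\<lambda>t. \<gamma> (min t l)"]) auto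
  qed
  then obtain \<Gamma> where \<Gamma>: "\<And>n. 1-lipschitz_on {0..L} (\<Gamma> n)" "\<And>n. \<Gamma> n 0 = x" "\<And>n. \<Gamma> n L = y"
    "\<And>n t. t \<in> {0..L} \<Longrightarrow> \<exists>k\<in>K. dist (\<Gamma> n t) k < inverse (real (Suc n))"
    by metis
  have lip: "norm (\<Gamma> n s - \<Gamma> n t) \<le> \<bar>s - t\<bar>" if "s \<in> {0..L}" "t \<in> {0..L}" for n s t
    using lipschitz_onD[OF \<Gamma>(1) that, of n] by (simp add: dist_norm)
  have M: "norm (\<Gamma> n t) \<le> norm x + L" if "t \<in> {0..L}" for n t
    using lip[OF that, of 0 n] \<Gamma>(2)[of n] that norm_triangle_sub[of "\<Gamma> n t" x] by auto
  have equi: "\<exists>d. 0 < d \<and> (\<forall>n t. t \<in> {0..L} \<and> norm (s - t) < d \<longrightarrow> norm (\<Gamma> n s - \<Gamma> n t) < e)"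
    if "s \<in> {0..L}" "0 < e" for s e
    using lip[OF that(1)] that(2) by (intro exI[of _ e]) (auto intro: le_less_trans)
  obtain g k where k: "strict_mono (k :: nat \<Rightarrow> nat)"
    and unif: "\<And>e. 0 < e \<Longrightarrow> \<exists>N. \<forall>n t. n \<ge> N \<and> t \<in> {0..L} \<longrightarrow> norm (\<Gamma> (k n) t - g t) < e"
  proof (rule Arzela_Ascoli[of "{0..L}" \<Gamma>, OF compact_Icc M equi])
    fix g and k :: "nat \<Rightarrow> nat"
    assume k: "strict_mono k"
      and unif: "\<And>e. 0 < e \<Longrightarrow> \<exists>N. \<forall>n t. n \<ge> N \<and> t \<in> {0..L} \<longrightarrow> norm (\<Gamma> (k n) t - g t) < e"
    show thesis
      by (rule that[OF k unif])
  qed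
  have lim: "(\<lambda>n. \<Gamma> (k n) t) \<longlonglongrightarrow> g t" if "t \<in> {0..L}" for t
    using unif that unfolding LIMSEQ_iff by blast
  show thesis
  proof (rule that)
    show "1-lipschitz_on {0..L} g"
    proof (rule lipschitz_onI)
      fix s t assume st: "s \<in> {0..L}" "t \<in> {0..L}"
      have "(\<lambda>n. dist (\<Gamma> (k n) s) (\<Gamma> (k n) t)) \<longlonglongrightarrow> dist (g s) (g t)"
        using lim st by (intro tendsto_dist)
      then show "dist (g s) (g t) \<le> 1 * dist s t"
        by (rule LIMSEQ_le_const2) (use lipschitz_onD[OF \<Gamma>(1) st] in blast)
    qed simp
    show "g 0 = x"
      using lim[of 0] L \<Gamma>(2) LIMSEQ_unique[OF _ tendsto_const] by auto
    show "g L = y"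
      using lim[of L] L \<Gamma>(3) LIMSEQ_unique[OF _ tendsto_const] by auto
    show "g ` {0..L} \<subseteq> K"
    proof clarify
      fix t assume t: "t \<in> {0..L}"
      obtain q where q: "\<And>n. q n \<in> K" "\<And>n. dist (\<Gamma> n t) (q n) < inverse (real (Suc n))"
        using \<Gamma>(4)[OF t] by metis
      have "(\<lambda>n. dist (\<Gamma> (k n) t) (q (k n))) \<longlonglongrightarrow> 0"
      proof (rule tendsto_sandwich[OF _ _ tendsto_const])
        show "(\<lambda>n. inverse (real (Suc (k n)))) \<longlonglongrightarrow> 0"
          using LIMSEQ_subseq_LIMSEQ[OF LIMSEQ_inverse_real_of_nat k] by (simp add: o_def)
      qed (use q(2) in \<open>auto intro!: always_eventually less_imp_le\<close>)
      then have "(\<lambda>n. \<Gamma> (k n) t - q (k n)) \<longlonglongrightarrow> 0"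
        by (simp add: dist_norm tendsto_norm_zero_iff)
      from tendsto_diff[OF lim[OF t] this] have "(\<lambda>n. q (k n)) \<longlonglongrightarrow> g t"
        by simp
      then show "g t \<in> K"
        by (rule closed_sequentially[OF compact_imp_closed[OF K] q(1)])
    qed
  qed
qed

section \<open>Length of 1-Lipschitz curves, and necessity of regularity\<close>

lemma lipschitz_partition_sum_le:
  fixes \<gamma> :: "real \<Rightarrow> 'a::metric_space"
  assumes "1-lipschitz_on {a..b} \<gamma>" "a \<le> b" "s \<in> partition_sums \<gamma> a b"
  shows "s \<le> b - a"
proof -
  obtain ts where ts: "sorted ts" "set ts \<subseteq> {a..b}"
    and s: "s = (\<Sum>j<length ts - 1. dist (\<gamma> (ts ! j)) (\<gamma> (ts ! Suc j)))"
    using assms(3) unfolding partition_sums_def by blast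
  show ?thesis
  proof (cases "ts = []")
    case True
    then show ?thesis using s assms(2) by simp
  next
    case False
    have mem: "ts ! j \<in> {a..b}" if "j < length ts" for j
      using ts(2) that nth_mem by blast
    have "s \<le> (\<Sum>j<length ts - 1. ts ! Suc j - ts ! j)"
      unfolding s
    proof (rule sum_mono)
      fix j assume "j \<in> {..<length ts - 1}"
      then have j: "j < length ts" "Suc j < length ts" by auto
      then have "ts ! j \<le> ts ! Suc j"
        using sorted_nth_mono[OF ts(1)] by simp
      then show "dist (\<gamma> (ts ! j)) (\<gamma> (ts ! Suc j)) \<le> ts ! Suc j - ts ! j"
        using lipschitz_onD[OF assms(1) mem[OF j(1)] mem[OF j(2)]] by (simp add: dist_real_def)
    qed
    also have "\<dots> = ts ! (length ts - 1) - ts ! 0"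
      by (rule sum_lessThan_telescope)
    also have "\<dots> \<le> b - a"
      using mem[of "length ts - 1"] mem[of 0] False by auto
    finally show ?thesis .
  qed
qed

lemma lipschitz_imp_rectifiable:
  assumes "1-lipschitz_on {a..b} \<gamma>" "a \<le> b"
  shows "rectifiable \<gamma> a b" "curve_length \<gamma> a b \<le> b - a"
proof -
  show "rectifiable \<gamma> a b"
    unfolding rectifiable_def using lipschitz_partition_sum_le[OF assms] by (rule bdd_aboveI)
  have "0 \<in> partition_sums \<gamma> a b"
    unfolding partition_sums_def by (auto intro!: exI[of _ "[]"])
  then have "partition_sums \<gamma> a b \<noteq> {}"
    by blast
  then show "curve_length \<gamma> a b \<le> b - a"
    unfolding curve_length_def using lipschitz_partition_sum_le[OF assms] by (rule cSup_least)
qed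

lemma C1_complete_imp_pointwise_whitney_regular:
  fixes K :: "'a::euclidean_space set"
  assumes K: "compact K" and complete: "C1_complete K"
  shows "pointwise_whitney_regular K"
  unfolding pointwise_whitney_regular_def
proof
  fix x assume x: "x \<in> K"
  obtain C where C: "0 < C"
    "\<And>f y. f \<in> C1 K \<Longrightarrow> y \<in> K \<Longrightarrow> \<bar>f y - f x\<bar> \<le> C * norm (y - x) * C1norm K f"
    using C1_complete_imp_uniform_increment_bound[OF K complete x] by blast
  \<comment> \<open>The factor 9 is the seminorm bound of the smoothed distance, the same for all
    \<epsilon>; evaluating it at \<open>y\<close> and at \<open>x\<close>, where the distance is 0,
    costs \<open>2 * \<delta> \<le> e\<close>.\<close>
  have dist_le: "chain_dist \<epsilon> K x y \<le> 9 * C * norm (y - x)" if \<epsilon>: "0 < \<epsilon>" and y: "y \<in> K" for \<epsilon> y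
  proof (rule field_le_epsilon)
    fix e :: real assume e: "0 < e"
    define \<delta> where "\<delta> = min 1 (e / 2)"
    have \<delta>: "0 < \<delta>" "\<delta> \<le> 1" "2 * \<delta> \<le> e"
      unfolding \<delta>_def using e by auto
    obtain F where F: "F \<in> C1 K" "C1norm K F \<le> 9"
      "\<And>z. z \<in> K \<Longrightarrow> \<bar>F z - chain_dist \<epsilon> K x z\<bar> \<le> \<delta>"
    proof (rule C1_approximation_locally_lipschitz[OF K \<epsilon> \<delta>(1,2), of "chain_dist \<epsilon> K x"])
      show "\<bar>chain_dist \<epsilon> K x y - chain_dist \<epsilon> K x z\<bar> \<le> norm (y - z)"
        if "y \<in> K" "z \<in> K" "norm (y - z) < \<epsilon>" for y z
        using chain_dist_lipschitz[of y K z \<epsilon> x] that by (simp add: dist_norm)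
    qed (use chain_dist_bounds in auto)
    have "\<bar>F y - F x\<bar> \<le> C * norm (y - x) * C1norm K F"
      using C(2) F(1) y by blast
    also have "\<dots> \<le> C * norm (y - x) * 9"
      using F(2) C(1) by (intro mult_left_mono) auto
    finally show "chain_dist \<epsilon> K x y \<le> 9 * C * norm (y - x) + e"
      using F(3)[OF y] F(3)[OF x] chain_dist_refl[OF x, of \<epsilon>] \<delta>(3) by (simp add: algebra_simps)
  qed
  \<comment> \<open>In this ball the chain distance is below 1, so it comes from actual chains and
    not from the truncation.\<close>
  define V where "V = ball x (1 / (9 * C))"
  have "\<exists>\<gamma> a b. a \<le> b \<and> continuous_on {a..b} \<gamma> \<and> \<gamma> ` {a..b} \<subseteq> K \<and> \<gamma> a = x \<and> \<gamma> b = y \<and>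
      rectifiable \<gamma> a b \<and> curve_length \<gamma> a b \<le> 18 * C * norm (x - y)" if y: "y \<in> V \<inter> K" for y
  proof -
    \<comment> \<open>Doubling \<open>9 * C\<close> makes the inequality strict for
      \<open>y \<noteq> x\<close>, so some chain is shorter than \<open>L\<close> although the
      infimum may not be attained; one \<open>L\<close> serves every \<epsilon>.\<close>
    define L where "L = 18 * C * norm (x - y)"
    have L: "0 \<le> L"
      unfolding L_def using C(1) by simp
    have small: "9 * C * norm (y - x) < 1"
      using y C(1) unfolding V_def by (simp add: dist_norm norm_minus_commute field_simps)
    have "\<exists>l\<le>L. chain \<epsilon> K x l y" if \<epsilon>: "0 < \<epsilon>" for \<epsilon>
    proof (cases "x = y")
      case True
      then show ?thesis using chain_refl[OF x] L by auto
    next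
      case False
      then have "9 * C * norm (y - x) < L"
        unfolding L_def using C(1) by (simp add: norm_minus_commute)
      then have "chain_dist \<epsilon> K x y < min 1 L"
        using dist_le[OF \<epsilon>, of y] y small by auto
      then have "\<exists>l\<in>insert 1 {l. chain \<epsilon> K x l y}. l < min 1 L"
        unfolding chain_dist_def by (rule cInf_lessD[rotated]) simp
      then show ?thesis by (auto intro: less_imp_le)
    qed
    then obtain \<gamma> where \<gamma>: "1-lipschitz_on {0..L} \<gamma>" "\<gamma> 0 = x" "\<gamma> L = y" "\<gamma> ` {0..L} \<subseteq> K"
      using lipschitz_path_of_chains[OF K L] by blast
    then show ?thesis
      using lipschitz_imp_rectifiable[OF \<gamma>(1) L] lipschitz_on_continuous_on[OF \<gamma>(1)] L
      unfolding L_def[symmetric] by (intro exI[of _ \<gamma>] exI[of _ 0] exI[of _ L]) auto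
  qed
  moreover have "open V" "x \<in> V" "0 < 18 * C"
    unfolding V_def using C(1) by auto
  ultimately show "\<exists>V C. open V \<and> x \<in> V \<and> 0 < C \<and> (\<forall>y\<in>V \<inter> K. \<exists>\<gamma> a b. a \<le> b \<and>
      continuous_on {a..b} \<gamma> \<and> \<gamma> ` {a..b} \<subseteq> K \<and> \<gamma> a = x \<and> \<gamma> b = y \<and>
      rectifiable \<gamma> a b \<and> curve_length \<gamma> a b \<le> C * norm (x - y))"
    by blast
qed

section \<open>The mean value inequality along rectifiable paths\<close>

definition partition_sum :: "(real \<Rightarrow> 'a::metric_space) \<Rightarrow> real list \<Rightarrow> real" where
  "partition_sum \<gamma> ts = (\<Sum>j<length ts - 1. dist (\<gamma> (ts ! j)) (\<gamma> (ts ! Suc j)))"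

lemma partition_sum_simps [simp]:
  "partition_sum \<gamma> [] = 0"
  "partition_sum \<gamma> [s] = 0"
  "partition_sum \<gamma> (s # t # ts) = dist (\<gamma> s) (\<gamma> t) + partition_sum \<gamma> (t # ts)"
  unfolding partition_sum_def by (simp_all add: sum.lessThan_Suc_shift del: sum.lessThan_Suc)

text \<open>Concatenation keeps all summands and can only add the distance across the
  junction.\<close>

lemma partition_sum_append:
  "partition_sum \<gamma> ts + partition_sum \<gamma> us \<le> partition_sum \<gamma> (ts @ us)"
proof (induction ts rule: induct_list012)
  case (2 t)
  then show ?case by (cases us) auto
qed auto

lemma C1_path_mean_value:
  fixes K :: "'a::euclidean_space set"
  assumes v: "is_C1_deriv K v dv" and M: "\<And>z. z \<in> K \<Longrightarrow> norm (dv z) \<le> M"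
    and ab: "a \<le> b" and cont: "continuous_on {a..b} \<gamma>" and sub: "\<gamma> ` {a..b} \<subseteq> K"
    and rect: "rectifiable \<gamma> a b"
  shows "\<bar>v (\<gamma> b) - v (\<gamma> a)\<bar> \<le> M * curve_length \<gamma> a b"
proof -
  have "0 \<le> M"
    using M[of "\<gamma> a"] sub ab norm_ge_zero order_trans by (metis atLeastAtMost_iff image_subset_iff order_refl)
  have len: "partition_sum \<gamma> ts \<le> curve_length \<gamma> a b" if "sorted ts" "set ts \<subseteq> {a..b}" for ts
    using rect that unfolding curve_length_def rectifiable_def
    by (intro cSup_upper) (auto simp: partition_sums_def partition_sum_def)
  have "0 \<le> curve_length \<gamma> a b"
    using len[of "[]"] by simp
  have bound: "\<bar>v (\<gamma> b) - v (\<gamma> a)\<bar> \<le> (M + e) * curve_length \<gamma> a b" if e: "0 < e" for e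
  proof -
    define P where "P s t \<longleftrightarrow> (a \<le> s \<and> s \<le> t \<and> t \<le> b \<longrightarrow>
      (\<exists>ts. sorted ts \<and> set ts \<subseteq> {s..t} \<and>
        \<bar>v (\<gamma> t) - v (\<gamma> s)\<bar> \<le> (M + e) * partition_sum \<gamma> ts))" for s t
    have "P a b"
      using ab
    proof (induction rule: Bolzano)
      case (trans r s t)
      show ?case
        unfolding P_def
      proof
        assume asm: "a \<le> r \<and> r \<le> t \<and> t \<le> b"
        obtain ts where ts: "sorted ts" "set ts \<subseteq> {r..s}"
          "\<bar>v (\<gamma> s) - v (\<gamma> r)\<bar> \<le> (M + e) * partition_sum \<gamma> ts"
          using trans asm unfolding P_def by auto
        obtain us where us: "sorted us" "set us \<subseteq> {s..t}"
          "\<bar>v (\<gamma> t) - v (\<gamma> s)\<bar> \<le> (M + e) * partition_sum \<gamma> us"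
          using trans asm unfolding P_def by auto
        have "sorted (ts @ us)"
          using ts(1,2) us(1,2) by (fastforce simp: sorted_append)
        moreover have "set (ts @ us) \<subseteq> {r..t}"
          using ts(2) us(2) trans(3,4) by fastforce
        moreover have "(M + e) * (partition_sum \<gamma> ts + partition_sum \<gamma> us)
            \<le> (M + e) * partition_sum \<gamma> (ts @ us)"
          using \<open>0 \<le> M\<close> e by (intro mult_left_mono partition_sum_append) auto
        then have "\<bar>v (\<gamma> t) - v (\<gamma> r)\<bar> \<le> (M + e) * partition_sum \<gamma> (ts @ us)"
          using ts(3) us(3) unfolding distrib_left by linarith
        ultimately show "\<exists>ts. sorted ts \<and> set ts \<subseteq> {r..t} \<and>
            \<bar>v (\<gamma> t) - v (\<gamma> r)\<bar> \<le> (M + e) * partition_sum \<gamma> ts"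
          by blast
      qed
    next
      case (local x)
      then have x: "x \<in> {a..b}" "\<gamma> x \<in> K"
        using sub by auto
      have "(v has_derivative inner (dv (\<gamma> x))) (at (\<gamma> x) within K)"
        using v x unfolding is_C1_deriv_iff_has_derivative by blast
      then have "\<exists>d>0. \<forall>y\<in>K. norm (y - \<gamma> x) < d \<longrightarrow>
          norm (v y - v (\<gamma> x) - inner (dv (\<gamma> x)) (y - \<gamma> x)) \<le> e * norm (y - \<gamma> x)"
        unfolding has_derivative_within_alt using e by blast
      then obtain d where d: "0 < d" "\<And>y. y \<in> K \<Longrightarrow> norm (y - \<gamma> x) < d \<Longrightarrow>
          \<bar>v y - v (\<gamma> x) - inner (dv (\<gamma> x)) (y - \<gamma> x)\<bar> \<le> e * norm (y - \<gamma> x)"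
        unfolding real_norm_def by blast
      obtain \<rho> where \<rho>: "0 < \<rho>" "\<And>s. s \<in> {a..b} \<Longrightarrow> dist s x < \<rho> \<Longrightarrow> dist (\<gamma> s) (\<gamma> x) < d"
        using cont x(1) d(1) unfolding continuous_on_iff by blast
      have near: "\<bar>v (\<gamma> s) - v (\<gamma> x)\<bar> \<le> (M + e) * dist (\<gamma> s) (\<gamma> x)"
        if s: "s \<in> {a..b}" "dist s x < \<rho>" for s
      proof -
        have "\<gamma> s \<in> K"
          using s sub by auto
        moreover have "norm (\<gamma> s - \<gamma> x) < d"
          using \<rho>(2)[OF s] by (simp add: dist_norm)
        ultimately have "\<bar>v (\<gamma> s) - v (\<gamma> x) - inner (dv (\<gamma> x)) (\<gamma> s - \<gamma> x)\<bar> \<le> e * norm (\<gamma> s - \<gamma> x)"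
          by (rule d(2))
        moreover have "\<bar>inner (dv (\<gamma> x)) (\<gamma> s - \<gamma> x)\<bar> \<le> M * norm (\<gamma> s - \<gamma> x)"
          by (rule order_trans[OF Cauchy_Schwarz_ineq2]) (intro mult_right_mono M x(2) norm_ge_zero)
        ultimately show ?thesis
          unfolding dist_norm distrib_right by linarith
      qed
      show ?case
      proof (intro exI[of _ \<rho>] conjI allI impI \<rho>(1))
        fix s t assume st: "s \<le> x \<and> x \<le> t \<and> t - s < \<rho>"
        show "P s t"
          unfolding P_def
        proof
          assume asm: "a \<le> s \<and> s \<le> t \<and> t \<le> b"
          have "\<bar>v (\<gamma> s) - v (\<gamma> x)\<bar> \<le> (M + e) * dist (\<gamma> s) (\<gamma> x)"
            "\<bar>v (\<gamma> t) - v (\<gamma> x)\<bar> \<le> (M + e) * dist (\<gamma> t) (\<gamma> x)"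
            using st asm by (auto intro!: near simp: dist_real_def)
          \<comment> \<open>The point \<open>x\<close> must be in the list because the derivative
            estimate is anchored at \<open>\<gamma> x\<close>.\<close>
          then have "\<bar>v (\<gamma> t) - v (\<gamma> s)\<bar> \<le> (M + e) * partition_sum \<gamma> [s, x, t]"
            unfolding partition_sum_simps distrib_left by (simp add: dist_commute)
          then show "\<exists>ts. sorted ts \<and> set ts \<subseteq> {s..t} \<and>
              \<bar>v (\<gamma> t) - v (\<gamma> s)\<bar> \<le> (M + e) * partition_sum \<gamma> ts"
            using st by (intro exI[of _ "[s, x, t]"]) auto
        qed
      qed
    qed
    then obtain ts where ts: "sorted ts" "set ts \<subseteq> {a..b}"
      "\<bar>v (\<gamma> b) - v (\<gamma> a)\<bar> \<le> (M + e) * partition_sum \<gamma> ts"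
      unfolding P_def using ab by auto
    moreover have "(M + e) * partition_sum \<gamma> ts \<le> (M + e) * curve_length \<gamma> a b"
      using len[OF ts(1,2)] \<open>0 \<le> M\<close> e by (intro mult_left_mono) auto
    ultimately show ?thesis by linarith
  qed
  show ?thesis
  proof (rule field_le_epsilon)
    fix e :: real assume "0 < e"
    define e' where "e' = e / (curve_length \<gamma> a b + 1)"
    have "0 < e'" "e' * curve_length \<gamma> a b \<le> e"
      unfolding e'_def using \<open>0 < e\<close> \<open>0 \<le> curve_length \<gamma> a b\<close> by (auto simp: field_simps)
    then show "\<bar>v (\<gamma> b) - v (\<gamma> a)\<bar> \<le> M * curve_length \<gamma> a b + e"
      using bound[of e'] by (simp add: distrib_right)
  qed
qed

section \<open>Completeness of regular sets\<close>

text \<open>The explicit rate, the same at every point of \<open>K\<close>, later turns pointwise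
  limits into uniform ones.\<close>

lemma geometric_increments_converge:
  fixes s :: "nat \<Rightarrow> 'a::banach"
  assumes step: "\<And>k. norm (s (Suc k) - s k) \<le> (1/2) ^ k"
  shows "\<exists>l. s \<longlonglongrightarrow> l \<and> (\<forall>k. norm (s k - l) \<le> 2 * (1/2) ^ k)"
proof -
  have tail: "norm (s (k + m) - s k) \<le> 2 * (1/2) ^ k - 2 * (1/2) ^ (k + m)" for k m
  proof (induction m)
    case (Suc m)
    have "norm (s (k + Suc m) - s k) \<le> norm (s (Suc (k + m)) - s (k + m)) + norm (s (k + m) - s k)"
      using norm_triangle_ineq[of "s (Suc (k + m)) - s (k + m)" "s (k + m) - s k"] by simp
    also have "\<dots> \<le> (1/2) ^ (k + m) + (2 * (1/2) ^ k - 2 * (1/2) ^ (k + m))"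
      by (intro add_mono step Suc.IH)
    also have "\<dots> = 2 * (1/2) ^ k - 2 * (1/2) ^ (k + Suc m)"
      by simp
    finally show ?case .
  qed simp
  have tail': "norm (s m - s k) \<le> 2 * (1/2) ^ k" if km: "k \<le> m" for k m
  proof -
    obtain j where j: "m = k + j"
      using km le_Suc_ex by blast
    show ?thesis
      unfolding j by (rule order_trans[OF tail]) simp
  qed
  have "Cauchy s"
    unfolding Cauchy_iff
  proof (intro allI impI)
    fix e :: real assume e: "0 < e"
    obtain N where N: "(1/2::real) ^ N < e / 4"
      using real_arch_pow_inv[of "e/4" "1/2"] e by auto
    have "norm (s m - s n) < e" if "m \<ge> N" "n \<ge> N" for m n
      using norm_triangle_ineq4[of "s m - s N" "s n - s N"] tail'[OF that(1)] tail'[OF that(2)] N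
      by simp
    then show "\<exists>M. \<forall>m\<ge>M. \<forall>n\<ge>M. norm (s m - s n) < e" by blast
  qed
  then obtain l where l: "s \<longlonglongrightarrow> l"
    using Cauchy_convergent_iff convergent_def by blast
  have "norm (s k - l) \<le> 2 * (1/2) ^ k" for k
  proof -
    have "(\<lambda>m. norm (s m - s k)) \<longlonglongrightarrow> norm (l - s k)"
      using l by (intro tendsto_intros)
    then have "norm (l - s k) \<le> 2 * (1/2) ^ k"
      by (rule LIMSEQ_le_const2) (use tail' in blast)
    then show ?thesis
      by (simp add: norm_minus_commute)
  qed
  then show ?thesis using l by blast
qed

text \<open>For \<open>m \<ge> k\<close> the derivative of \<open>w m - w k\<close> is uniformly
  small, so a path from \<open>x\<close> to \<open>y\<close> makes its increment small relative to
  \<open>|x - y|\<close>; then \<open>m\<close> tends to infinity. All paths start at the point of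
  differentiation, so \<open>C\<close> may vary with \<open>x\<close>.\<close>

lemma is_C1_deriv_limit:
  fixes K :: "'a::euclidean_space set"
  assumes regular: "pointwise_whitney_regular K"
    and w: "\<And>k. is_C1_deriv K (w k) (h k)"
    and f: "\<And>x. x \<in> K \<Longrightarrow> (\<lambda>k. w k x) \<longlonglongrightarrow> f x"
    and H: "\<And>k x. x \<in> K \<Longrightarrow> norm (h k x - H x) \<le> 2 * (1/2) ^ k"
  shows "is_C1_deriv K f H"
proof -
  have small: "\<exists>k. c * (1/2) ^ k < e" if "0 < c" "0 < e" for c e :: real
  proof -
    obtain k where "(1/2::real) ^ k < e / c"
      using real_arch_pow_inv[of "e / c" "1/2"] \<open>0 < c\<close> \<open>0 < e\<close> by auto
    then show ?thesis
      using \<open>0 < c\<close> by (auto simp: field_simps)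
  qed
  have "uniform_limit K h H sequentially"
  proof (rule uniform_limitI)
    fix e :: real assume "0 < e"
    then obtain N where N: "2 * (1/2) ^ N < e"
      using small[of 2 e] by auto
    have "dist (h n x) (H x) < e" if "N \<le> n" "x \<in> K" for n x
    proof -
      have "(1/2::real) ^ n \<le> (1/2) ^ N"
        using \<open>N \<le> n\<close> by (intro power_decreasing) auto
      then show ?thesis
        using H[OF \<open>x \<in> K\<close>, of n] N unfolding dist_norm by linarith
    qed
    then show "\<forall>\<^sub>F n in sequentially. \<forall>x\<in>K. dist (h n x) (H x) < e"
      unfolding eventually_sequentially by blast
  qed
  then have "continuous_on K H"
    by (rule uniform_limit_theorem[rotated]) (use w in \<open>auto simp: is_C1_deriv_def\<close>)
  moreover have "(f has_derivative inner (H x)) (at x within K)" if x: "x \<in> K" for x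
    unfolding has_derivative_within_alt
  proof (intro conjI allI impI bounded_linear_inner_right)
    fix e :: real assume e: "0 < e"
    obtain V C where V: "open V" "x \<in> V" "0 < C"
      and path: "\<And>y. y \<in> V \<inter> K \<Longrightarrow> \<exists>\<gamma> a b. a \<le> b \<and> continuous_on {a..b} \<gamma> \<and> \<gamma> ` {a..b} \<subseteq> K \<and>
        \<gamma> a = x \<and> \<gamma> b = y \<and> rectifiable \<gamma> a b \<and> curve_length \<gamma> a b \<le> C * norm (x - y)"
      using regular x unfolding pointwise_whitney_regular_def by meson
    obtain r where r: "0 < r" "ball x r \<subseteq> V"
      using V open_contains_ball by blast
    \<comment> \<open>\<open>4 * C\<close> pays for the increment of \<open>f - w k\<close> along
      the path and 2 for replacing \<open>h k x\<close> by \<open>H x\<close>; the other half of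
      \<open>e\<close> goes to the differentiability of \<open>w k\<close>.\<close>
    obtain k where k: "(4 * C + 2) * (1/2) ^ k < e / 2"
      using small[of "4 * C + 2" "e / 2"] V(3) e by auto
    define \<eta> :: real where "\<eta> = (1/2) ^ k"
    have "(w k has_derivative inner (h k x)) (at x within K)"
      using w x unfolding is_C1_deriv_iff_has_derivative by blast
    then have "\<exists>d>0. \<forall>y\<in>K. norm (y - x) < d \<longrightarrow>
        norm (w k y - w k x - inner (h k x) (y - x)) \<le> e / 2 * norm (y - x)"
      unfolding has_derivative_within_alt using e half_gt_zero by blast
    then obtain d where d: "0 < d" "\<And>y. y \<in> K \<Longrightarrow> norm (y - x) < d \<Longrightarrow>
        \<bar>w k y - w k x - inner (h k x) (y - x)\<bar> \<le> e / 2 * norm (y - x)"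
      unfolding real_norm_def by blast
    have "norm (f y - f x - inner (H x) (y - x)) \<le> e * norm (y - x)"
      if y: "y \<in> K" "norm (y - x) < min d r" for y
    proof -
      have "y \<in> V \<inter> K"
        using y r(2) by (auto simp: dist_norm norm_minus_commute)
      then obtain \<gamma> a b where \<gamma>: "a \<le> b" "continuous_on {a..b} \<gamma>" "\<gamma> ` {a..b} \<subseteq> K"
        "\<gamma> a = x" "\<gamma> b = y" "rectifiable \<gamma> a b" "curve_length \<gamma> a b \<le> C * norm (x - y)"
        using path by meson
      have "\<bar>(w m y - w k y) - (w m x - w k x)\<bar> \<le> 4 * \<eta> * (C * norm (x - y))" if "k \<le> m" for m
      proof -
        have "norm (h m z - h k z) \<le> 4 * \<eta>" if z: "z \<in> K" for z
        proof -
          have "(1/2::real) ^ m \<le> \<eta>"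
            unfolding \<eta>_def using \<open>k \<le> m\<close> by (intro power_decreasing) auto
          moreover have "norm (h m z - h k z) \<le> norm (h m z - H z) + norm (h k z - H z)"
            using norm_triangle_ineq4[of "h m z - H z" "h k z - H z"] by simp
          ultimately show ?thesis
            using H[OF z, of m] H[OF z, of k] unfolding \<eta>_def by linarith
        qed
        then have "\<bar>(w m (\<gamma> b) - w k (\<gamma> b)) - (w m (\<gamma> a) - w k (\<gamma> a))\<bar>
            \<le> 4 * \<eta> * curve_length \<gamma> a b"
          by (rule C1_path_mean_value[OF is_C1_deriv_diff[OF w w] _ \<gamma>(1,2,3,6)])
        also have "\<dots> \<le> 4 * \<eta> * (C * norm (x - y))"
          using \<gamma>(7) by (intro mult_left_mono) (auto simp: \<eta>_def)
        finally show ?thesis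
          using \<gamma>(4,5) by simp
      qed
      moreover have "(\<lambda>m. \<bar>(w m y - w k y) - (w m x - w k x)\<bar>)
          \<longlonglongrightarrow> \<bar>(f y - w k y) - (f x - w k x)\<bar>"
        using f[OF x] f[OF y(1)] by (intro tendsto_intros)
      ultimately have "\<bar>(f y - w k y) - (f x - w k x)\<bar> \<le> 4 * \<eta> * (C * norm (x - y))"
        by (intro LIMSEQ_le_const2) auto
      moreover have "4 * \<eta> * (C * norm (x - y)) = 4 * C * \<eta> * norm (y - x)"
        by (simp add: norm_minus_commute)
      moreover have "\<bar>inner (h k x - H x) (y - x)\<bar> \<le> 2 * \<eta> * norm (y - x)"
        by (rule order_trans[OF Cauchy_Schwarz_ineq2])
          (use H[OF x, of k] in \<open>auto simp: \<eta>_def intro!: mult_right_mono\<close>)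
      moreover have "\<bar>w k y - w k x - inner (h k x) (y - x)\<bar> \<le> e / 2 * norm (y - x)"
        using d(2) y by simp
      ultimately have "\<bar>f y - f x - inner (H x) (y - x)\<bar>
          \<le> 4 * C * \<eta> * norm (y - x) + 2 * \<eta> * norm (y - x) + e / 2 * norm (y - x)"
        unfolding inner_diff_left by linarith
      also have "\<dots> = ((4 * C + 2) * \<eta> + e / 2) * norm (y - x)"
        by (simp add: algebra_simps)
      also have "\<dots> \<le> e * norm (y - x)"
        using k unfolding \<eta>_def by (intro mult_right_mono) auto
      finally show ?thesis by simp
    qed
    then show "\<exists>d>0. \<forall>y\<in>K. norm (y - x) < d \<longrightarrow>
        norm (f y - f x - inner (H x) (y - x)) \<le> e * norm (y - x)"
      using d(1) r(1) by (intro exI[of _ "min d r"]) auto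
  qed
  ultimately show ?thesis
    unfolding is_C1_deriv_iff_has_derivative by blast
qed

text \<open>Derivatives chosen separately for each \<open>u n\<close> need not converge, since they
  are not unique. Along a fast subsequence \<open>w\<close> the differences have small derivatives
  \<open>g k\<close>, and adding these to one derivative of \<open>w 0\<close> gives a uniformly
  convergent choice \<open>h\<close>.\<close>

lemma pointwise_whitney_regular_imp_C1_complete:
  fixes K :: "'a::euclidean_space set"
  assumes K: "compact K" and regular: "pointwise_whitney_regular K"
  shows "C1_complete K"
  unfolding C1_complete_def
proof (intro allI impI, elim conjE)
  fix u :: "nat \<Rightarrow> 'a \<Rightarrow> real"
  assume "\<forall>n. u n \<in> C1 K" and cauchy: "\<forall>e>0. \<exists>N. \<forall>m\<ge>N. \<forall>n\<ge>N. C1norm K (\<lambda>x. u m x - u n x) < e"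
  then have u: "u n \<in> C1 K" for n
    by blast
  have "\<exists>N. \<forall>m\<ge>N. \<forall>n\<ge>N. C1norm K (\<lambda>x. u m x - u n x) < (1/2) ^ k" for k :: nat
    using cauchy by simp
  then obtain N where N: "\<And>k m n. m \<ge> N k \<Longrightarrow> n \<ge> N k \<Longrightarrow> C1norm K (\<lambda>x. u m x - u n x) < (1/2) ^ k"
    by metis
  \<comment> \<open>A nondecreasing choice of indices with both \<open>r k\<close> and
    \<open>r (Suc k)\<close> past \<open>N k\<close>.\<close>
  define r where "r k = (\<Sum>j\<le>k. Suc (N j))" for k
  have r: "N k \<le> r k" "r k \<le> r (Suc k)" "k \<le> r k" for k
  proof -
    show "N k \<le> r k" "r k \<le> r (Suc k)"
      unfolding r_def by (cases k; simp)+
    show "k \<le> r k"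
      unfolding r_def by (induction k) auto
  qed
  define w where "w k = u (r k)" for k
  have "\<exists>g. is_C1_deriv K (\<lambda>x. w (Suc k) x - w k x) g \<and>
      (\<forall>x\<in>K. \<bar>w (Suc k) x - w k x\<bar> \<le> (1/2) ^ k \<and> norm (g x) \<le> (1/2) ^ k)" for k
  proof -
    have small: "C1norm K (\<lambda>x. w (Suc k) x - w k x) < (1/2) ^ k"
      unfolding w_def using r(1)[of k] r(2)[of k] by (intro N) auto
    have "(\<lambda>x. w (Suc k) x - w k x) \<in> C1 K"
      unfolding w_def by (intro C1_diff u)
    from K this small show ?thesis
    proof (rule C1norm_lessE)
      fix g A B
      assume g: "is_C1_deriv K (\<lambda>x. w (Suc k) x - w k x) g"
        and AB: "0 \<le> A" "0 \<le> B" "A + B < (1/2) ^ k"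
        and le: "\<And>x. x \<in> K \<Longrightarrow> \<bar>w (Suc k) x - w k x\<bar> \<le> A" "\<And>x. x \<in> K \<Longrightarrow> norm (g x) \<le> B"
      have "\<bar>w (Suc k) x - w k x\<bar> \<le> (1/2) ^ k \<and> norm (g x) \<le> (1/2) ^ k" if "x \<in> K" for x
        using le[OF that] AB by linarith
      then show ?thesis
        using g by blast
    qed
  qed
  then obtain g where g: "\<And>k. is_C1_deriv K (\<lambda>x. w (Suc k) x - w k x) (g k)"
    and w_step: "\<And>k x. x \<in> K \<Longrightarrow> \<bar>w (Suc k) x - w k x\<bar> \<le> (1/2) ^ k"
    and g_le: "\<And>k x. x \<in> K \<Longrightarrow> norm (g k x) \<le> (1/2) ^ k"
    by metis
  obtain h0 where h0: "is_C1_deriv K (w 0) h0"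
    using u unfolding w_def C1_def by blast
  define h where "h k x = h0 x + (\<Sum>j<k. g j x)" for k x
  have wh: "is_C1_deriv K (w k) (h k)" for k
  proof (induction k)
    case 0
    then show ?case using h0 unfolding h_def by simp
  next
    case (Suc k)
    have "h (Suc k) = (\<lambda>x. h k x + g k x)"
      unfolding h_def by (simp add: add.assoc)
    then show ?case
      using is_C1_deriv_add[OF Suc g[of k]] by simp
  qed
  have "\<exists>l. (\<lambda>k. w k x) \<longlonglongrightarrow> l \<and> (\<forall>k. norm (w k x - l) \<le> 2 * (1/2) ^ k)" if "x \<in> K" for x
    using w_step[OF that] by (intro geometric_increments_converge) simp
  then obtain f where f: "\<And>x. x \<in> K \<Longrightarrow> (\<lambda>k. w k x) \<longlonglongrightarrow> f x"
    and wf: "\<And>x k. x \<in> K \<Longrightarrow> norm (w k x - f x) \<le> 2 * (1/2) ^ k"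
    by metis
  have "\<exists>l. (\<lambda>k. h k x) \<longlonglongrightarrow> l \<and> (\<forall>k. norm (h k x - l) \<le> 2 * (1/2) ^ k)" if "x \<in> K" for x
    using g_le[OF that] by (intro geometric_increments_converge) (simp add: h_def)
  then obtain H where hH: "\<And>k x. x \<in> K \<Longrightarrow> norm (h k x - H x) \<le> 2 * (1/2) ^ k"
    by metis
  have fH: "is_C1_deriv K f H"
    by (rule is_C1_deriv_limit[OF regular wh f hH])
  then have "f \<in> C1 K"
    unfolding C1_def by blast
  have w_near: "C1norm K (\<lambda>x. w k x - f x) \<le> 2 * (1/2) ^ k + 2 * (1/2) ^ k" for k
    by (rule C1norm_le[OF K is_C1_deriv_diff[OF wh fH]]) (use wf hH in auto)
  have "(\<lambda>n. C1norm K (\<lambda>x. u n x - f x)) \<longlonglongrightarrow> 0"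
    unfolding LIMSEQ_iff
  proof (intro allI impI)
    fix e :: real assume e: "0 < e"
    \<comment> \<open>\<open>w_near\<close> costs four times \<open>(1/2) ^ k\<close>, the Cauchy
      property one more.\<close>
    obtain k where k: "(1/2::real) ^ k < e / 5"
      using real_arch_pow_inv[of "e/5" "1/2"] e by auto
    have "norm (C1norm K (\<lambda>x. u n x - f x) - 0) < e" if n: "n \<ge> N k" for n
    proof -
      have "C1norm K (\<lambda>x. u n x - f x) \<le> C1norm K (\<lambda>x. u n x - w k x) + C1norm K (\<lambda>x. w k x - f x)"
        unfolding w_def by (rule C1norm_diff_triangle[OF K u u \<open>f \<in> C1 K\<close>])
      moreover have "C1norm K (\<lambda>x. u n x - w k x) < (1/2) ^ k"
        unfolding w_def by (rule N[OF n r(1)])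
      ultimately show ?thesis
        using w_near[of k] k C1norm_nonneg[OF K C1_diff[OF u \<open>f \<in> C1 K\<close>], of n] by simp
    qed
    then show "\<exists>no. \<forall>n\<ge>no. norm (C1norm K (\<lambda>x. u n x - f x) - 0) < e" by blast
  qed
  then show "\<exists>f\<in>C1 K. (\<lambda>n. C1norm K (\<lambda>x. u n x - f x)) \<longlonglongrightarrow> 0"
    using \<open>f \<in> C1 K\<close> by blast
qed

section \<open>Connected components\<close>

text \<open>Paths are connected, so a regular neighbourhood of \<open>x\<close> meets
  \<open>K\<close> only in the component of \<open>x\<close>; a finite subcover then bounds the
  number of components, and the paths already run inside them.\<close>

lemma pointwise_whitney_regular_iff_components:
  fixes K :: "'a::euclidean_space set"
  assumes K: "compact K"
  shows "pointwise_whitney_regular K \<longleftrightarrow>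
           finite (components K) \<and> (\<forall>C\<in>components K. pointwise_whitney_regular C)"
proof (intro iffI conjI ballI; (elim conjE)?)
  assume regular: "pointwise_whitney_regular K"
  then have "\<forall>x\<in>K. \<exists>V M. open V \<and> x \<in> V \<and> M > 0 \<and>
      (\<forall>y\<in>V \<inter> K. \<exists>\<gamma> a b. a \<le> b \<and> continuous_on {a..b} \<gamma> \<and> \<gamma> ` {a..b} \<subseteq> K \<and> \<gamma> a = x \<and> \<gamma> b = y \<and>
        rectifiable \<gamma> a b \<and> curve_length \<gamma> a b \<le> M * norm (x - y))"
    unfolding pointwise_whitney_regular_def .
  then obtain V M where V: "\<And>x. x \<in> K \<Longrightarrow> open (V x)" "\<And>x. x \<in> K \<Longrightarrow> x \<in> V x"
    and M: "\<And>x. x \<in> K \<Longrightarrow> 0 < M x"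
    and path: "\<And>x y. x \<in> K \<Longrightarrow> y \<in> V x \<inter> K \<Longrightarrow> \<exists>\<gamma> a b. a \<le> b \<and> continuous_on {a..b} \<gamma> \<and>
      \<gamma> ` {a..b} \<subseteq> K \<and> \<gamma> a = x \<and> \<gamma> b = y \<and> rectifiable \<gamma> a b \<and>
      curve_length \<gamma> a b \<le> M x * norm (x - y)"
    unfolding bchoice_iff Ball_def by metis
  have path': "\<exists>\<gamma> a b. a \<le> b \<and> continuous_on {a..b} \<gamma> \<and>
      \<gamma> ` {a..b} \<subseteq> connected_component_set K x \<and> \<gamma> a = x \<and> \<gamma> b = y \<and> rectifiable \<gamma> a b \<and>
      curve_length \<gamma> a b \<le> M x * norm (x - y)" if xy: "x \<in> K" "y \<in> V x \<inter> K" for x y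
  proof -
    obtain \<gamma> a b where \<gamma>: "a \<le> b" "continuous_on {a..b} \<gamma>" "\<gamma> ` {a..b} \<subseteq> K" "\<gamma> a = x" "\<gamma> b = y"
      "rectifiable \<gamma> a b" "curve_length \<gamma> a b \<le> M x * norm (x - y)"
      using path[OF xy] by blast
    have "connected (\<gamma> ` {a..b})"
      by (intro connected_continuous_image \<gamma>(2) connected_Icc)
    moreover have "x \<in> \<gamma> ` {a..b}"
      using \<gamma>(1,4) by force
    ultimately have "\<gamma> ` {a..b} \<subseteq> connected_component_set K x"
      by (intro connected_component_maximal \<gamma>(3))
    then show ?thesis
      using \<gamma> by blast
  qed
  show "finite (components K)"
  proof -
    have cover: "K \<subseteq> (\<Union>x\<in>K. V x)"
      using V(2) by blast
    obtain F where F: "F \<subseteq> K" "finite F" "K \<subseteq> (\<Union>x\<in>F. V x)"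
      by (rule compactE_image[OF K V(1) cover]) (assumption, rule that)
    have "components K \<subseteq> connected_component_set K ` F"
    proof
      fix S assume "S \<in> components K"
      then obtain y where y: "y \<in> K" "S = connected_component_set K y"
        unfolding components_def by blast
      then obtain x where x: "x \<in> F" "y \<in> V x"
        using F(3) by blast
      then obtain \<gamma> a b where "a \<le> (b::real)" "\<gamma> ` {a..b} \<subseteq> connected_component_set K x" "\<gamma> b = y"
        using path'[of x y] y(1) F(1) by blast
      moreover from this(1) have "\<gamma> b \<in> \<gamma> ` {a..b}"
        by simp
      ultimately have "y \<in> connected_component_set K x"
        by blast
      then have "S = connected_component_set K x"
        unfolding y(2) by (metis connected_component_eq)
      then show "S \<in> connected_component_set K ` F"
        using x(1) by blast
    qed
    then show ?thesis
      using F(2) finite_surj by blast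
  qed
  fix S assume S: "S \<in> components K"
  show "pointwise_whitney_regular S"
    unfolding pointwise_whitney_regular_def
  proof
    fix x assume x: "x \<in> S"
    have "x \<in> K"
      using S x in_components_subset by blast
    obtain z where z: "S = connected_component_set K z"
      using S unfolding components_def by blast
    have "S = connected_component_set K x"
      using connected_component_eq[of x K z] x unfolding z by blast
    then have "\<exists>\<gamma> a b. a \<le> b \<and> continuous_on {a..b} \<gamma> \<and> \<gamma> ` {a..b} \<subseteq> S \<and> \<gamma> a = x \<and> \<gamma> b = y \<and>
        rectifiable \<gamma> a b \<and> curve_length \<gamma> a b \<le> M x * norm (x - y)" if "y \<in> V x \<inter> S" for y
      using path'[OF \<open>x \<in> K\<close>, of y] that in_components_subset[OF S] by auto
    then show "\<exists>V C. open V \<and> x \<in> V \<and> 0 < C \<and> (\<forall>y\<in>V \<inter> S. \<exists>\<gamma> a b. a \<le> b \<and>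
        continuous_on {a..b} \<gamma> \<and> \<gamma> ` {a..b} \<subseteq> S \<and> \<gamma> a = x \<and> \<gamma> b = y \<and>
        rectifiable \<gamma> a b \<and> curve_length \<gamma> a b \<le> C * norm (x - y))"
      using V[OF \<open>x \<in> K\<close>] M[OF \<open>x \<in> K\<close>] by (intro exI[of _ "V x"] exI[of _ "M x"]) blast
  qed
next
  assume fin: "finite (components K)" and regular: "\<forall>C\<in>components K. pointwise_whitney_regular C"
  show "pointwise_whitney_regular K"
    unfolding pointwise_whitney_regular_def
  proof
    fix x assume x: "x \<in> K"
    define S where "S = connected_component_set K x"
    have S: "S \<in> components K" "x \<in> S"
      unfolding S_def components_def using x by auto
    then obtain V C where V: "open V" "x \<in> V" "0 < C"
      and path: "\<And>y. y \<in> V \<inter> S \<Longrightarrow> \<exists>\<gamma> a b. a \<le> b \<and> continuous_on {a..b} \<gamma> \<and> \<gamma> ` {a..b} \<subseteq> S \<and>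
        \<gamma> a = x \<and> \<gamma> b = y \<and> rectifiable \<gamma> a b \<and> curve_length \<gamma> a b \<le> C * norm (x - y)"
      using regular unfolding pointwise_whitney_regular_def by meson
    \<comment> \<open>Finiteness makes the union of the other, closed components closed; removing it
      leaves a neighbourhood of \<open>x\<close> that meets \<open>K\<close> only inside
      \<open>S\<close>.\<close>
    define U where "U = V - \<Union>(components K - {S})"
    have "closed (\<Union>(components K - {S}))"
      using fin closed_components[OF compact_imp_closed[OF K]] by (intro closed_Union) auto
    then have "open U"
      unfolding U_def using V(1) by (rule open_Diff[rotated])
    moreover have "x \<in> U"
    proof -
      have "x \<notin> T" if "T \<in> components K - {S}" for T
        using components_nonoverlap[of T K S] that S by auto
      then show ?thesis
        unfolding U_def using V(2) by auto
    qed
    moreover have "y \<in> V \<inter> S" if "y \<in> U \<inter> K" for y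
      using that Union_components[of K] unfolding U_def by blast
    moreover have "S \<subseteq> K"
      using S(1) in_components_subset by blast
    ultimately show "\<exists>V C. open V \<and> x \<in> V \<and> 0 < C \<and> (\<forall>y\<in>V \<inter> K. \<exists>\<gamma> a b. a \<le> b \<and>
        continuous_on {a..b} \<gamma> \<and> \<gamma> ` {a..b} \<subseteq> K \<and> \<gamma> a = x \<and> \<gamma> b = y \<and>
        rectifiable \<gamma> a b \<and> curve_length \<gamma> a b \<le> C * norm (x - y))"
      using path V(3) by (intro exI[of _ U] exI[of _ C]) (meson subset_trans)
  qed
qed

theorem mainTheorem10:
  fixes K :: "'a::euclidean_space set"
  assumes "compact K"
  shows "C1_complete K \<longleftrightarrow>
           finite (components K) \<and> (\<forall>C\<in>components K. pointwise_whitney_regular C)"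
  using C1_complete_imp_pointwise_whitney_regular[OF assms]
    pointwise_whitney_regular_imp_C1_complete[OF assms]
    pointwise_whitney_regular_iff_components[OF assms]
  by blast

end
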